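(* Let $\Omega_1$ and $\Omega_2$ be finitely connected domains in the plane such that no boundary component of either is a point, and suppose that the Bergman kernel functions of $\Omega_1$ and of $\Omega_2$ are both algebraic. If $\Phi:\Omega_1\to\Omega_2$ is a biholomorphic mapping, then $\Phi$ is an algebraic function.
   Context: A domain in the plane is finitely connected if its complement in the Riemann sphere has finitely many connected components; "no boundary component is a point" means that none of these components is a single point. The Bergman kernel $K(z,w)$ of $\Omega$ is the kernel of the orthogonal projection of $L^2(\Omega)$ (area measure) onto its subspace of holomorphic functions. A holomorphic function $\Phi(z)$ of one variable is algebraic if there is a nonzero polynomial $P$ of two complex variables with $P(\Phi(z),z)\equiv0$. A holomorphic function $A(z,w)$ on an open set in $\mathbb{C}\times\mathbb{C}$ is algebraic if there is a nonzero polynomial $P$ of three complex variables with $P(A(z,w),z,w)\equiv0$. The Bergman kernel $K(z,w)$ of $\Omega$ is called algebraic if it can be written as $K(z,w)=R(z,\bar w)$ with $R$ a holomorphic algebraic function of two variables on $\{(z,\bar w):(z,w)\in\Omega\times\Omega\}$. *)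

theory Defs
  imports "HOL-Complex_Analysis.Complex_Analysis" "HOL-Computational_Algebra.Polynomial"
begin

definition plane_domain :: "complex set \<Rightarrow> bool" where
  "plane_domain \<Omega> \<longleftrightarrow> open \<Omega> \<and> connected \<Omega> \<and> \<Omega> \<noteq> {}"

(* The Riemann sphere is the Euclidean unit sphere of complex * real, with the plane embedded
   by inverse stereographic projection from the north pole (0, 1), the point at infinity. *)
definition to_sphere :: "complex \<Rightarrow> complex \<times> real" where
  "to_sphere z =
     (2 * z / of_real ((cmod z)\<^sup>2 + 1), ((cmod z)\<^sup>2 - 1) / ((cmod z)\<^sup>2 + 1))"

lemma homeomorphism_to_sphere:
  "homeomorphism UNIV (sphere 0 1 - {(0, 1)}) to_sphere (\<lambda>(z, t). z / of_real (1 - t))"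
proof (rule homeomorphismI)
  have pos: "(cmod z)\<^sup>2 + 1 > 0" for z
    by (simp add: add_nonneg_pos)
  have pos': "complex_of_real ((cmod z)\<^sup>2 + 1) \<noteq> 0" for z
    using pos[of z] by (metis of_real_eq_0_iff less_irrefl)
  show "continuous_on UNIV to_sphere"
    unfolding to_sphere_def
    by (intro continuous_intros) (use pos pos' in \<open>force simp: less_le\<close>)+
  have ne: "t \<noteq> 1" if "(z, t) \<in> sphere 0 1 - {(0, 1)}" for z :: complex and t :: real
    using that by (auto simp: norm_Pair)
  show "continuous_on (sphere 0 1 - {(0, 1)}) (\<lambda>(z::complex, t::real). z / of_real (1 - t))"
    unfolding case_prod_unfold
    by (intro continuous_intros) (use ne in force)
  show "to_sphere ` UNIV \<subseteq> sphere 0 1 - {(0, 1)}"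
  proof (rule image_subsetI)
    fix z
    define r where "r = (cmod z)\<^sup>2"
    have r: "r + 1 > 0" using pos[of z] by (simp add: r_def)
    have "cmod (2 * z / of_real (r + 1)) = 2 * cmod z / (r + 1)"
      using r by (simp only: norm_divide norm_mult norm_of_real) simp
    then have "(cmod (fst (to_sphere z)))\<^sup>2 + (snd (to_sphere z))\<^sup>2
                 = 4 * r / (r + 1)\<^sup>2 + (r - 1)\<^sup>2 / (r + 1)\<^sup>2"
      by (simp add: to_sphere_def power_divide power_mult_distrib flip: r_def)
    also have "\<dots> = (4 * r + (r - 1)\<^sup>2) / (r + 1)\<^sup>2"
      by (simp add: add_divide_distrib)
    also have "4 * r + (r - 1)\<^sup>2 = (r + 1)\<^sup>2"
      by (simp add: power2_eq_square algebra_simps)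
    finally have "norm (to_sphere z) = 1"
      using r by (simp add: norm_prod_def)
    moreover have "(r - 1) / (r + 1) \<noteq> 1"
      using r by (simp add: field_simps)
    then have "to_sphere z \<noteq> (0, 1)" by (simp add: to_sphere_def r_def)
    ultimately show "to_sphere z \<in> sphere 0 1 - {(0, 1)}" by simp
  qed
  show "(\<lambda>(z, t). z / of_real (1 - t)) ` (sphere 0 1 - {(0, 1)}) \<subseteq> UNIV" by simp
  show "(case to_sphere z of (z, t) \<Rightarrow> z / of_real (1 - t)) = z" for z
  proof -
    define r where "r = (cmod z)\<^sup>2"
    have r: "r + 1 > 0" using pos[of z] by (simp add: r_def)
    have c: "complex_of_real (r + 1) \<noteq> 0" using pos'[of z] by (simp add: r_def)
    have "1 - (r - 1) / (r + 1) = 2 / (r + 1)"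
      using r by (simp add: field_simps)
    then have "(case to_sphere z of (z, t) \<Rightarrow> z / of_real (1 - t))
        = 2 * z / of_real (r + 1) / of_real (2 / (r + 1))"
      unfolding to_sphere_def prod.case r_def[symmetric] by (simp only:)
    also have "\<dots> = z"
      unfolding of_real_divide using c by simp
    finally show ?thesis .
  qed
  show "to_sphere (case p of (z, t) \<Rightarrow> z / of_real (1 - t)) = p" if "p \<in> sphere 0 1 - {(0, 1)}" for p
  proof (cases p)
    case (Pair z t)
    have t: "t \<noteq> 1" using ne that Pair by blast
    have "(cmod z)\<^sup>2 + t\<^sup>2 = 1"
      using that Pair by (simp add: norm_Pair)
    then have z: "(cmod z)\<^sup>2 = (1 - t) * (1 + t)" by (simp add: power2_eq_square algebra_simps)
    have n: "(cmod (z / of_real (1 - t)))\<^sup>2 = (1 + t) / (1 - t)"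
    proof -
      have "(cmod (z / of_real (1 - t)))\<^sup>2 = (cmod z)\<^sup>2 / (1 - t)\<^sup>2"
        by (simp only: norm_divide norm_of_real power_divide power2_abs)
      then show ?thesis unfolding z using t by (simp add: power2_eq_square)
    qed
    have 1: "(1 + t) / (1 - t) + 1 = 2 / (1 - t)" and 2: "(1 + t) / (1 - t) - 1 = 2 * t / (1 - t)"
      using t by (simp_all add: field_simps)
    have "complex_of_real (1 - t) \<noteq> 0"
      using t by (metis of_real_eq_0_iff right_minus_eq)
    then show ?thesis
      unfolding Pair to_sphere_def prod.case n 1 2 of_real_divide using t by simp
  qed
qed

definition complement_components :: "complex set \<Rightarrow> (complex \<times> real) set set" where
  "complement_components \<Omega> = components (sphere 0 1 - to_sphere ` \<Omega>)"

definition finitely_connected :: "complex set \<Rightarrow> bool" where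
  "finitely_connected \<Omega> \<longleftrightarrow> finite (complement_components \<Omega>)"

definition no_point_boundary_component :: "complex set \<Rightarrow> bool" where
  "no_point_boundary_component \<Omega> \<longleftrightarrow> (\<forall>C \<in> complement_components \<Omega>. \<nexists>p. C = {p})"

definition L2_space :: "complex set \<Rightarrow> (complex \<Rightarrow> complex) set" where
  "L2_space \<Omega> = {f \<in> borel_measurable (lebesgue_on \<Omega>).
                   integrable (lebesgue_on \<Omega>) (\<lambda>z. (cmod (f z))\<^sup>2)}"

definition L2_inner :: "complex set \<Rightarrow> (complex \<Rightarrow> complex) \<Rightarrow> (complex \<Rightarrow> complex) \<Rightarrow> complex" where
  "L2_inner \<Omega> f g = (LINT z|lebesgue_on \<Omega>. f z * cnj (g z))"

definition bergman_space :: "complex set \<Rightarrow> (complex \<Rightarrow> complex) set" where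
  "bergman_space \<Omega> = {f \<in> L2_space \<Omega>. f holomorphic_on \<Omega>}"

definition is_bergman_projection ::
    "complex set \<Rightarrow> (complex \<Rightarrow> complex) \<Rightarrow> (complex \<Rightarrow> complex) \<Rightarrow> bool" where
  "is_bergman_projection \<Omega> f h \<longleftrightarrow>
     h \<in> bergman_space \<Omega> \<and> (\<forall>g \<in> bergman_space \<Omega>. L2_inner \<Omega> (\<lambda>z. f z - h z) g = 0)"

(* K is the integral kernel of the orthogonal projection.  For fixed z that property determines
   K(z, w) only for almost every w; the first clause selects the representative that is
   antiholomorphic in w, so that K is unique on \<Omega> \<times> \<Omega>. *)
definition is_bergman_kernel :: "complex set \<Rightarrow> (complex \<Rightarrow> complex \<Rightarrow> complex) \<Rightarrow> bool" where
  "is_bergman_kernel \<Omega> K \<longleftrightarrow>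
     (\<forall>z \<in> \<Omega>. (\<lambda>w. cnj (K z w)) \<in> bergman_space \<Omega>) \<and>
     (\<forall>f \<in> L2_space \<Omega>. is_bergman_projection \<Omega> f (\<lambda>z. LINT w|lebesgue_on \<Omega>. K z w * f w))"

(* Polynomials in two and three variables are iterated univariate polynomials; the first
   argument x is substituted for the outermost variable. *)
definition eval_poly2 :: "complex poly poly \<Rightarrow> complex \<Rightarrow> complex \<Rightarrow> complex" where
  "eval_poly2 P x y = poly (poly P [:x:]) y"

definition eval_poly3 ::
    "complex poly poly poly \<Rightarrow> complex \<Rightarrow> complex \<Rightarrow> complex \<Rightarrow> complex" where
  "eval_poly3 P x y z = poly (poly (poly P [:[:x:]:]) [:y:]) z"

definition algebraic_on :: "complex set \<Rightarrow> (complex \<Rightarrow> complex) \<Rightarrow> bool" where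
  "algebraic_on S f \<longleftrightarrow>
     f holomorphic_on S \<and> (\<exists>P. P \<noteq> 0 \<and> (\<forall>z \<in> S. eval_poly2 P (f z) z = 0))"

(* Holomorphy in two variables: Frechet differentiability with complex-linear derivative.
   Only meant for open S. *)
definition holomorphic2_on :: "(complex \<times> complex) set \<Rightarrow> (complex \<times> complex \<Rightarrow> complex) \<Rightarrow> bool" where
  "holomorphic2_on S A \<longleftrightarrow>
     (\<forall>p \<in> S. \<exists>a b. (A has_derivative (\<lambda>(u, v). a * u + b * v)) (at p))"

definition algebraic2_on :: "(complex \<times> complex) set \<Rightarrow> (complex \<times> complex \<Rightarrow> complex) \<Rightarrow> bool" where
  "algebraic2_on S A \<longleftrightarrow>
     holomorphic2_on S A \<and>
     (\<exists>P. P \<noteq> 0 \<and> (\<forall>(z, w) \<in> S. eval_poly3 P (A (z, w)) z w = 0))"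

definition algebraic_kernel :: "complex set \<Rightarrow> (complex \<Rightarrow> complex \<Rightarrow> complex) \<Rightarrow> bool" where
  "algebraic_kernel \<Omega> K \<longleftrightarrow>
     (\<exists>R. algebraic2_on {(z, cnj w) | z w. z \<in> \<Omega> \<and> w \<in> \<Omega>} R \<and>
          (\<forall>z \<in> \<Omega>. \<forall>w \<in> \<Omega>. K z w = R (z, cnj w)))"

definition biholomorphic :: "complex set \<Rightarrow> complex set \<Rightarrow> (complex \<Rightarrow> complex) \<Rightarrow> bool" where
  "biholomorphic S T f \<longleftrightarrow>
     f holomorphic_on S \<and> bij_betw f S T \<and> inv_into S f holomorphic_on T"

end

theory Submission
  imports Defs "HOL-Algebra.Algebraic_Closure_Type"
begin

text \<open>
  The mapping \<open>\<Phi>\<close> transports one Bergman kernel to the other: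
  \<open>K\<^sub>1(z,w) = \<Phi>'(z) K\<^sub>2(\<Phi>(z),\<Phi>(w)) cnj (\<Phi>'(w))\<close>.  The factor \<open>\<Phi>'(z)\<close>,
  about which nothing is known in advance, disappears from quotients of two columns of the kernel: for fixed points \<open>p \<noteq> q\<close>,
  \<open>K\<^sub>1(z,p) / K\<^sub>1(z,q) = k \<sqdot> K\<^sub>2(\<Phi>(z),\<Phi>(p)) / K\<^sub>2(\<Phi>(z),\<Phi>(q))\<close> with a constant \<open>k\<close>.
  Call this function \<open>r\<close>.  A column of an algebraic kernel is an algebraic function for all but finitely
  many base points, so for suitable \<open>p\<close> and \<open>q\<close> the left side shows that \<open>r\<close> is algebraic over
  \<open>\<complex>(z)\<close>, and the right side that it is algebraic over \<open>\<complex>(\<Phi>)\<close>.  If \<open>r\<close> is not constant, it is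
  transcendental over \<open>\<complex>\<close>, hence the relation between \<open>r\<close> and \<open>\<Phi>\<close> really involves \<open>\<Phi>\<close>, and
  \<open>\<Phi>\<close> is algebraic over \<open>\<complex>(r)\<close>, a subfield of the algebraic closure of \<open>\<complex>(z)\<close>.  This is
  the lemma \<open>algebraic_via_common_quotient\<close>, which is applied to Laurent expansions at a point of
  the domain.

  That \<open>r\<close> is not constant is where the boundary matters.  If the columns at \<open>p\<close> and \<open>q\<close> were
  proportional, the reproducing property would make the values \<open>f(p)\<close> and \<open>f(q)\<close> of all \<open>f\<close> in
  the Bergman space proportional with one and the same factor.  The component of the complement of
  the domain in the sphere that contains the point at infinity is not a single point, so the domain
  lies in a simply connected proper subset of the plane.  Its Riemann map \<open>g\<close> is bounded and
  injective, and \<open>g'\<close> and \<open>g' g\<close> lie in the Bergman space, since they are the pullbacks of the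
  bounded functions \<open>1\<close> and \<open>z\<close> on the image of the domain.  Their quotient \<open>g\<close>
  separates \<open>p\<close> and \<open>q\<close>, a contradiction.
\<close>

section \<open>Change of variables under injective holomorphic maps\<close>

text \<open>
  The change of variables theorem for Lebesgue integrals lives on spaces of the form \<open>real ^ 'n\<close>;
  these two inverse isometries carry it over to the complex plane.
\<close>

definition vec_of :: "complex \<Rightarrow> real^2" where
  "vec_of z = (\<chi> i. if i = 1 then Re z else Im z)"

definition of_vec :: "real^2 \<Rightarrow> complex" where
  "of_vec x = Complex (x $ 1) (x $ 2)"

lemma of_vec_vec_of [simp]: "of_vec (vec_of z) = z"
  by (simp add: of_vec_def vec_of_def)

lemma vec_of_of_vec [simp]: "vec_of (of_vec x) = x"
  by (simp add: of_vec_def vec_of_def vec_eq_iff forall_2)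

lemma linear_of_vec: "linear of_vec"
  by (rule linearI) (simp_all add: of_vec_def complex_eq_iff)

lemma linear_vec_of: "linear vec_of"
  by (rule linearI) (simp_all add: vec_of_def vec_eq_iff)

lemmas bounded_linear_of_vec = linear_of_vec[THEN linear_conv_bounded_linear[THEN iffD1]]
lemmas bounded_linear_vec_of = linear_vec_of[THEN linear_conv_bounded_linear[THEN iffD1]]

lemma measurable_of_vec [measurable]: "of_vec \<in> borel_measurable borel"
  by (intro borel_measurable_continuous_onI linear_continuous_on bounded_linear_of_vec)

lemma lborel_complex_eq: "lborel = distr lborel borel of_vec"
proof (rule lborel_eqI)
  fix l u :: complex
  assume le: "\<And>b. b \<in> Basis \<Longrightarrow> l \<bullet> b \<le> u \<bullet> b"
  have box: "of_vec -` box l u = box (vec_of l) (vec_of u)"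
    by (auto simp: in_box_complex_iff of_vec_def mem_box_cart vec_of_def forall_2)
  have "emeasure (distr lborel borel of_vec) (box l u) = emeasure lborel (box (vec_of l) (vec_of u))"
    by (simp add: emeasure_distr box)
  also have "\<dots> = (\<Prod>b\<in>Basis. (vec_of u - vec_of l) \<bullet> b)"
    using le[of 1] le[of \<i>]
    by (intro emeasure_lborel_box) (auto simp: Basis_complex_def axis_eq_axis Basis_vec_def vec_of_def inner_axis)
  also have "(\<Prod>b\<in>Basis. (vec_of u - vec_of l) \<bullet> b) = (\<Prod>i\<in>UNIV. (vec_of u - vec_of l) $ i)"
  proof -
    have B: "(Basis :: (real^2) set) = (\<lambda>i. axis i 1) ` UNIV"
      by (auto simp: Basis_vec_def)
    have inj: "inj (\<lambda>i::2. axis i (1::real))"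
      by (simp add: inj_on_def axis_eq_axis)
    show ?thesis
      unfolding B prod.reindex[OF inj] by (simp add: inner_axis)
  qed
  also have "\<dots> = (\<Prod>b\<in>Basis. (u - l) \<bullet> b)"
    by (simp add: Basis_complex_def UNIV_2 vec_of_def)
  finally show "emeasure (distr lborel borel of_vec) (box l u) = (\<Prod>b\<in>Basis. (u - l) \<bullet> b)" .
qed simp

lemma det_mult_matrix: "det (matrix (\<lambda>x. vec_of (d * of_vec x))) = (cmod d)\<^sup>2"
  unfolding cmod_power2
  by (simp add: det_2 matrix_def vec_of_def of_vec_def axis_def power2_eq_square)

text \<open>
  For a function that is continuous on an open set, extension by zero is Borel measurable.  So its
  integrals with respect to Lebesgue measure and to its Borel restriction agree, and the
  latter can be transported as an image measure.
\<close>

lemma lebesgue_of_vec: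
  fixes f :: "complex \<Rightarrow> 'b::euclidean_space"
  assumes "open S" "continuous_on S f"
  shows "integrable (lebesgue_on S) f \<longleftrightarrow> (f \<circ> of_vec) absolutely_integrable_on (of_vec -` S)"
    and "integral\<^sup>L (lebesgue_on S) f = set_lebesgue_integral lebesgue (of_vec -` S) (f \<circ> of_vec)"
proof -
  define h where "h = (\<lambda>z. indicator S z *\<^sub>R f z)"
  have h: "h \<in> borel_measurable borel"
    unfolding h_def by (intro borel_measurable_continuous_on_indicator assms borel_open)
  have h': "(\<lambda>x. h (of_vec x)) \<in> borel_measurable borel"
    using h measurable_of_vec by measurable
  have S: "S \<in> sets lebesgue" using assms by auto
  have eq: "(\<lambda>x. h (of_vec x)) = (\<lambda>x. indicator (of_vec -` S) x *\<^sub>R (f \<circ> of_vec) x)"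
    by (auto simp: h_def indicator_def)
  have "integrable (lebesgue_on S) f \<longleftrightarrow> integrable lebesgue h"
    unfolding h_def by (subst integrable_restrict_space) (use S in auto)
  also have "\<dots> \<longleftrightarrow> integrable lborel h" 
    using h by (intro integrable_completion) auto
  also have "\<dots> \<longleftrightarrow> integrable lborel (\<lambda>x. h (of_vec x))"
    using h by (subst lborel_complex_eq, subst integrable_distr_eq) auto
  also have "\<dots> \<longleftrightarrow> integrable lebesgue (\<lambda>x. h (of_vec x))"
    using h' by (intro integrable_completion[symmetric]) auto
  finally show "integrable (lebesgue_on S) f \<longleftrightarrow> (f \<circ> of_vec) absolutely_integrable_on (of_vec -` S)"
    by (simp only: eq set_integrable_def)
  have "integral\<^sup>L (lebesgue_on S) f = integral\<^sup>L lebesgue h"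
    unfolding h_def by (subst integral_restrict_space) (use S in auto)
  also have "\<dots> = integral\<^sup>L lborel h" 
    using h by (intro integral_completion) auto
  also have "\<dots> = integral\<^sup>L lborel (\<lambda>x. h (of_vec x))"
    using h by (subst lborel_complex_eq, subst integral_distr) auto
  also have "\<dots> = integral\<^sup>L lebesgue (\<lambda>x. h (of_vec x))"
    using h' by (intro integral_completion[symmetric]) auto
  finally show "integral\<^sup>L (lebesgue_on S) f = set_lebesgue_integral lebesgue (of_vec -` S) (f \<circ> of_vec)"
    by (simp only: eq set_lebesgue_integral_def)
qed

lemma absolutely_integrable_vec_of:
  fixes f :: "real^2 \<Rightarrow> complex"
  shows "(\<lambda>x. vec_of (f x)) absolutely_integrable_on A \<longleftrightarrow> f absolutely_integrable_on A"
proof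
  assume "(\<lambda>x. vec_of (f x)) absolutely_integrable_on A"
  from absolutely_integrable_linear[OF this bounded_linear_of_vec]
  show "f absolutely_integrable_on A" by (simp add: o_def)
next
  assume "f absolutely_integrable_on A"
  from absolutely_integrable_linear[OF this bounded_linear_vec_of]
  show "(\<lambda>x. vec_of (f x)) absolutely_integrable_on A" by (simp add: o_def)
qed

text \<open>
  As a real linear map, multiplication by \<open>deriv g z\<close> has determinant \<open>(cmod (deriv g z))\<^sup>2\<close>.
\<close>

theorem holomorphic_change_of_variables:
  fixes f g :: "complex \<Rightarrow> complex"
  assumes S: "open S" and g: "g holomorphic_on S" and inj: "inj_on g S"
    and f: "continuous_on (g ` S) f"
  shows "integrable (lebesgue_on (g ` S)) f \<longleftrightarrow>
           integrable (lebesgue_on S) (\<lambda>z. of_real ((cmod (deriv g z))\<^sup>2) * f (g z))"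
    and "integral\<^sup>L (lebesgue_on (g ` S)) f =
           integral\<^sup>L (lebesgue_on S) (\<lambda>z. of_real ((cmod (deriv g z))\<^sup>2) * f (g z))"
proof -
  define T where "T = of_vec -` S"
  define G where "G = (\<lambda>x. vec_of (g (of_vec x)))"
  define G' where "G' = (\<lambda>x y. vec_of (deriv g (of_vec x) * of_vec y))"
  define F where "F = (\<lambda>x. vec_of (f (of_vec x)))"
  define h where "h = (\<lambda>z. of_real ((cmod (deriv g z))\<^sup>2) * f (g z))"
  have gS: "open (g ` S)" using open_mapping_thm3[OF g S inj] .
  have contg: "continuous_on S g" using g by (rule holomorphic_on_imp_continuous_on)
  have conth: "continuous_on S h"
    unfolding h_def using f holomorphic_deriv[OF g S]
    by (intro continuous_intros continuous_on_compose2[OF f contg] holomorphic_on_imp_continuous_on) auto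
  have "open T"
    unfolding T_def using linear_continuous_on[OF bounded_linear_of_vec] S
    by (rule open_vimage[rotated])
  then have T: "T \<in> sets lebesgue"
    by auto
  have der: "(G has_derivative G' x) (at x within T)" if "x \<in> T" for x
  proof -
    have "(g has_field_derivative deriv g (of_vec x)) (at (of_vec x))"
      using that g S by (auto simp: T_def intro: holomorphic_derivI)
    then have "(g has_derivative (*) (deriv g (of_vec x))) (at (of_vec x))"
      by (simp add: has_field_derivative_def)
    from bounded_linear.has_derivative[OF bounded_linear_vec_of
        has_derivative_compose[OF bounded_linear_imp_has_derivative[OF bounded_linear_of_vec] this]]
    show ?thesis
      unfolding G_def G'_def by (rule has_derivative_at_withinI)
  qed
  have injG: "inj_on G T"
    using inj unfolding inj_on_def T_def G_def
    by (metis of_vec_vec_of vec_of_of_vec vimage_eq)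
  have img: "G ` T = of_vec -` (g ` S)"
  proof -
    have "y \<in> G ` T" if y: "y \<in> of_vec -` (g ` S)" for y
    proof -
      from y obtain z where z: "z \<in> S" "of_vec y = g z" by auto
      then have "y = G (vec_of z)"
        unfolding G_def by (metis of_vec_vec_of vec_of_of_vec)
      moreover have "vec_of z \<in> T"
        using z by (simp add: T_def)
      ultimately show ?thesis by blast
    qed
    then show ?thesis
      by (auto simp: G_def T_def)
  qed
  have det: "\<bar>det (matrix (G' x))\<bar> = (cmod (deriv g (of_vec x)))\<^sup>2" for x
    unfolding G'_def by (simp add: det_mult_matrix)
  have eq: "(\<lambda>x. \<bar>det (matrix (G' x))\<bar> *\<^sub>R F (G x)) = (\<lambda>x. vec_of ((h \<circ> of_vec) x))"
    unfolding det F_def G_def h_def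
    by (simp only: linear_scale[OF linear_vec_of, symmetric]
      scaleR_conv_of_real[where 'a = complex, symmetric] o_def of_vec_vec_of)
  note cov = has_absolute_integral_change_of_variables[OF T der injG, of F, unfolded eq img]
  have F: "F absolutely_integrable_on A \<longleftrightarrow> (f \<circ> of_vec) absolutely_integrable_on A" for A
    unfolding F_def by (simp add: absolutely_integrable_vec_of o_def)
  have "integrable (lebesgue_on (g ` S)) f \<longleftrightarrow> integrable (lebesgue_on S) h"
    unfolding lebesgue_of_vec(1)[OF gS f] lebesgue_of_vec(1)[OF S conth]
    using cov F absolutely_integrable_vec_of[where f = "h \<circ> of_vec"] unfolding T_def by metis
  then show "integrable (lebesgue_on (g ` S)) f \<longleftrightarrow>
           integrable (lebesgue_on S) (\<lambda>z. of_real ((cmod (deriv g z))\<^sup>2) * f (g z))"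
    by (simp add: h_def)
  have "integral\<^sup>L (lebesgue_on (g ` S)) f = integral\<^sup>L (lebesgue_on S) h"
  proof (cases "integrable (lebesgue_on (g ` S)) f")
    case True
    then have f': "(f \<circ> of_vec) absolutely_integrable_on (of_vec -` (g ` S))"
      by (simp add: lebesgue_of_vec(1)[OF gS f])
    moreover from this have h': "(h \<circ> of_vec) absolutely_integrable_on T"
      using cov F absolutely_integrable_vec_of[where f = "h \<circ> of_vec"] by metis
    ultimately have "integral T (\<lambda>x. vec_of ((h \<circ> of_vec) x)) = integral (of_vec -` (g ` S)) F"
      using cov F by metis
    then have "vec_of (integral T (h \<circ> of_vec)) = vec_of (integral (of_vec -` (g ` S)) (f \<circ> of_vec))"
      using integral_linear[OF set_lebesgue_integral_eq_integral(1)[OF f'] bounded_linear_vec_of]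
        integral_linear[OF set_lebesgue_integral_eq_integral(1)[OF h'] bounded_linear_vec_of]
      by (simp add: F_def o_def)
    then have "integral T (h \<circ> of_vec) = integral (of_vec -` (g ` S)) (f \<circ> of_vec)"
      by (metis of_vec_vec_of)
    then show ?thesis
      using f' h' unfolding lebesgue_of_vec(2)[OF gS f] lebesgue_of_vec(2)[OF S conth]
      by (simp add: set_lebesgue_integral_eq_integral(2) T_def)
  next
    case False
    with \<open>integrable (lebesgue_on (g ` S)) f \<longleftrightarrow> integrable (lebesgue_on S) h\<close> show ?thesis
      by (simp add: not_integrable_integral_eq)
  qed
  then show "integral\<^sup>L (lebesgue_on (g ` S)) f =
           integral\<^sup>L (lebesgue_on S) (\<lambda>z. of_real ((cmod (deriv g z))\<^sup>2) * f (g z))"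
    by (simp add: h_def)
qed

section \<open>Domains whose complement has a nondegenerate component at infinity\<close>

lemma continuous_to_sphere: "continuous_on UNIV to_sphere"
  by (rule homeomorphism_cont1[OF homeomorphism_to_sphere])

lemma range_to_sphere: "range to_sphere = sphere 0 1 - {(0, 1)}"
  by (rule homeomorphism_image1[OF homeomorphism_to_sphere])

lemma inj_to_sphere: "inj to_sphere"
  using homeomorphism_apply1[OF homeomorphism_to_sphere] by (rule inj_on_inverseI)

lemma to_sphere_ne_infinity: "to_sphere z \<noteq> (0, 1)" and to_sphere_in_sphere: "to_sphere z \<in> sphere 0 1"
  using rangeI[of to_sphere z] unfolding range_to_sphere by simp_all

lemma infinity_in_sphere: "(0 :: complex, 1 :: real) \<in> sphere 0 1"
  by (simp add: norm_Pair)

lemma openin_image_to_sphere: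
  assumes "open U"
  shows "openin (top_of_set (sphere 0 1)) (to_sphere ` U)"
proof (rule openin_trans)
  show "openin (top_of_set (sphere 0 1 - {(0, 1)})) (to_sphere ` U)"
    using homeomorphism_imp_open_map[OF homeomorphism_to_sphere, of U] assms by simp
  show "openin (top_of_set (sphere 0 1)) (sphere 0 1 - {(0 :: complex, 1 :: real)})"
    by (simp add: openin_delete)
qed

lemma to_sphere_preimage:
  assumes "p \<in> sphere 0 1" "p \<noteq> (0, 1)"
  obtains z where "p = to_sphere z"
proof -
  have "p \<in> range to_sphere"
    unfolding range_to_sphere using assms by simp
  then show ?thesis using that by blast
qed

text \<open>
  The winding number around a point is locally constant off the path and vanishes far away, so it
  extends, by the value \<open>0\<close> at infinity, to a locally constant function on the part of the sphere off the
  path.  A connected set that contains the point at infinity and avoids the path sees only the value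
  \<open>0\<close>.
\<close>

lemma winding_number_zero_across_sphere:
  assumes D: "connected D" "D \<subseteq> sphere 0 1" "(0, 1) \<in> D"
    and \<gamma>: "path \<gamma>" "pathfinish \<gamma> = pathstart \<gamma>" "to_sphere ` path_image \<gamma> \<inter> D = {}"
    and a: "to_sphere a \<in> D"
  shows "winding_number \<gamma> a = 0"
proof (rule ccontr)
  assume nz: "winding_number \<gamma> a \<noteq> 0"
  let ?S = "sphere 0 1 :: (complex \<times> real) set"
  define L where "L = (\<lambda>k. {z. z \<notin> path_image \<gamma> \<and> winding_number \<gamma> z = k})"
  define B where "B = to_sphere ` (\<Union>k\<in>-{0}. L k)"
  obtain R where R: "path_image \<gamma> \<subseteq> ball 0 R"
    using bounded_subset_ballD[OF bounded_path_image[OF \<gamma>(1)], of 0] by blast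
  define A where "A = to_sphere ` L 0 \<union> (?S - to_sphere ` cball 0 R)"
  have openL: "open (L k)" for k
    unfolding L_def by (rule open_winding_number_levelsets[OF \<gamma>(1,2)])
  have compact: "compact (to_sphere ` cball 0 R)"
    by (intro compact_continuous_image continuous_on_subset[OF continuous_to_sphere]) auto
  have A: "openin (top_of_set ?S) A"
    unfolding A_def using openL compact openin_open_Int[of "- to_sphere ` cball 0 R" ?S]
    by (intro openin_Un openin_image_to_sphere) (auto simp: Diff_eq open_Compl compact_imp_closed)
  have B: "openin (top_of_set ?S) B"
    unfolding B_def using openL by (intro openin_image_to_sphere) auto
  \<comment> \<open>Outside a disc that contains the path the winding number is zero; this makes \<open>A\<close> a neighbourhood of infinity.\<close>
  have far: "z \<in> L 0" if "z \<notin> cball 0 R" for z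
    using that R winding_number_zero_outside[OF \<gamma>(1) convex_cball \<gamma>(2), of z 0 R]
    unfolding L_def by fastforce
  have "A \<inter> B = {}"
  proof -
    have "to_sphere z \<notin> A" if "z \<in> L k" "k \<noteq> 0" for z k
    proof -
      from that have "z \<notin> L 0" by (auto simp: L_def)
      with far have "z \<in> cball 0 R" by blast
      with \<open>z \<notin> L 0\<close> show ?thesis
        unfolding A_def by (auto simp: inj_image_mem_iff[OF inj_to_sphere])
    qed
    then show ?thesis unfolding B_def by blast
  qed
  moreover have "D \<subseteq> A \<union> B"
  proof
    fix p assume p: "p \<in> D"
    show "p \<in> A \<union> B"
    proof (cases "p = (0,1)")
      case True
      then have "p \<in> ?S - to_sphere ` cball 0 R"
        using infinity_in_sphere to_sphere_ne_infinity by (metis DiffI imageE)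
      then show ?thesis by (simp add: A_def)
    next
      case False
      then obtain z where z: "p = to_sphere z"
        using p D(2) to_sphere_preimage by blast
      with p \<gamma>(3) have "z \<notin> path_image \<gamma>" by auto
      then show ?thesis
        unfolding z A_def B_def L_def by auto
    qed
  qed
  moreover have "(0, 1) \<in> A"
    unfolding A_def using infinity_in_sphere to_sphere_ne_infinity by (metis DiffI UnI2 imageE)
  moreover have "to_sphere a \<in> B"
  proof -
    have "a \<notin> path_image \<gamma>" using a \<gamma>(3) by auto
    then show ?thesis using nz by (auto simp: B_def L_def)
  qed
  moreover obtain A' B' where "open A'" "A = ?S \<inter> A'" "open B'" "B = ?S \<inter> B'"
    using A B by (auto simp: openin_open)
  ultimately show False
    using connectedD[OF D(1), of A' B'] D(2,3) a by blast
qed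

text \<open>
  Let \<open>C\<close> be the component of the complement that contains the point at infinity.  The component of the rest of
  the sphere that contains \<open>\<Omega>\<close> has connected complement, because \<open>C\<close> and the sphere are connected.  Hence
  no closed path in it winds around a point outside it, which makes it simply connected.  It is not the
  whole plane since \<open>C\<close> contains a finite point.
\<close>

lemma simply_connected_superset:
  assumes dom: "plane_domain \<Omega>" and np: "no_point_boundary_component \<Omega>"
  obtains U where "open U" "simply_connected U" "\<Omega> \<subseteq> U" "U \<noteq> UNIV"
proof -
  let ?S = "sphere 0 1 :: (complex \<times> real) set"
  define N :: "complex \<times> real" where "N = (0, 1)"
  define C where "C = connected_component_set (?S - to_sphere ` \<Omega>) N"
  have N: "N \<in> ?S - to_sphere ` \<Omega>"
    using infinity_in_sphere to_sphere_ne_infinity unfolding N_def by (metis DiffI imageE)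
  then have NC: "N \<in> C" by (simp add: C_def)
  have C: "C \<in> components (?S - to_sphere ` \<Omega>)"
    using N unfolding C_def components_def by blast
  then have "C \<noteq> {N}"
    using np unfolding no_point_boundary_component_def complement_components_def by blast
  with NC obtain p where p: "p \<in> C" "p \<noteq> N" by blast
  have CS: "C \<subseteq> ?S - to_sphere ` \<Omega>"
    using C by (rule in_components_subset)
  then obtain a where a: "p = to_sphere a"
    using p to_sphere_preimage[of p] unfolding N_def by blast
  have "closedin (top_of_set ?S) (?S - to_sphere ` \<Omega>)"
    using openin_image_to_sphere dom by (auto simp: plane_domain_def)
  then have "closed (?S - to_sphere ` \<Omega>)"
    using closed_sphere closedin_closed_eq by blast
  then have "closed C" using C closed_components by blast
  have conC: "connected C" using C in_components_connected by blast
  have con\<Omega>: "connected (to_sphere ` \<Omega>)"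
    using dom by (auto simp: plane_domain_def intro: connected_continuous_image continuous_on_subset[OF continuous_to_sphere])
  obtain E where E: "E \<in> components (?S - C)" "to_sphere ` \<Omega> \<subseteq> E"
  proof -
    have "to_sphere ` \<Omega> \<subseteq> ?S - C" 
      using CS to_sphere_in_sphere by blast
    moreover have "to_sphere ` \<Omega> \<noteq> {}" 
      using dom by (auto simp: plane_domain_def)
    ultimately show ?thesis
      using exists_component_superset[of "to_sphere ` \<Omega>" "?S - C"] con\<Omega> that by blast
  qed
  have ES: "E \<subseteq> ?S - C" using E(1) by (rule in_components_subset)
  define D where "D = ?S - E"
  have "connected ?S" by (rule connected_sphere) simp
  then have "connected D"
    unfolding D_def using conC CS E(1) component_diff_connected[of C ?S E] by blast
  have CD: "C \<subseteq> D" using CS ES by (auto simp: D_def)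
  have "openin (top_of_set ?S) (?S - C)"
    using \<open>closed C\<close> unfolding Diff_eq by (intro openin_open_Int open_Compl)
  moreover have "openin (top_of_set (?S - C)) E"
  proof (rule openin_components_locally_connected[OF _ E(1)])
    show "locally connected (?S - C)"
      using locally_connected_sphere calculation locally_open_subset by blast
  qed
  ultimately have openE: "openin (top_of_set ?S) E" using openin_trans by blast
  define U where "U = to_sphere -` E"
  have opU: "open U"
  proof -
    have "openin (top_of_set UNIV) (UNIV \<inter> to_sphere -` E)"
      by (rule continuous_openin_preimage[OF continuous_to_sphere _ openE]) (use to_sphere_in_sphere in blast)
    then show ?thesis by (simp add: U_def)
  qed
  have "E \<subseteq> ?S - {N}" using ES NC by auto
  have "U = (\<lambda>(z, t). z / of_real (1 - t)) ` E" (is "U = ?g ` E")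
  proof (intro equalityI subsetI)
    fix z assume "z \<in> U"
    moreover have "z = ?g (to_sphere z)"
      using homeomorphism_apply1[OF homeomorphism_to_sphere, of z] by simp
    ultimately show "z \<in> ?g ` E" unfolding U_def by blast
  next
    fix z assume "z \<in> ?g ` E"
    then obtain p where p: "p \<in> E" "z = ?g p" by blast
    then have "to_sphere z = p"
      using homeomorphism_apply2[OF homeomorphism_to_sphere, of p] \<open>E \<subseteq> ?S - {N}\<close>
      unfolding N_def by blast
    then show "z \<in> U" using p by (simp add: U_def)
  qed
  moreover have "connected E" using E(1) in_components_connected by blast
  moreover have "continuous_on E (\<lambda>(z, t). z / of_real (1 - t))"
    using homeomorphism_cont2[OF homeomorphism_to_sphere] \<open>E \<subseteq> ?S - {N}\<close>
    unfolding N_def by (rule continuous_on_subset)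
  ultimately have conU: "connected U"
    using connected_continuous_image by blast
  have sc: "simply_connected U"
    unfolding simply_connected_eq_winding_number_zero[OF opU]
  proof (intro conjI allI impI conU)
    fix \<gamma> z assume \<gamma>: "path \<gamma> \<and> path_image \<gamma> \<subseteq> U \<and> pathfinish \<gamma> = pathstart \<gamma> \<and> z \<notin> U"
    show "winding_number \<gamma> z = 0"
    proof (rule winding_number_zero_across_sphere[OF \<open>connected D\<close>])
      show "D \<subseteq> ?S" "(0, 1) \<in> D" using CD NC by (auto simp: D_def N_def)
      show "to_sphere ` path_image \<gamma> \<inter> D = {}" using \<gamma> by (auto simp: D_def U_def)
      show "to_sphere z \<in> D" using \<gamma> to_sphere_in_sphere by (auto simp: D_def U_def)
    qed (use \<gamma> in auto)
  qed
  have "\<Omega> \<subseteq> U" using E(2) by (auto simp: U_def)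
  moreover have "a \<notin> U" using p(1) CD by (auto simp: U_def D_def a)
  ultimately show ?thesis using that opU sc by blast
qed

section \<open>The Bergman space and its reproducing kernel\<close>

lemma holomorphic_measurable_lebesgue:
  assumes "open \<Omega>" "f holomorphic_on \<Omega>"
  shows "f \<in> borel_measurable (lebesgue_on \<Omega>)"
  using assms by (intro continuous_imp_measurable_on_sets_lebesgue holomorphic_on_imp_continuous_on) auto

lemma bergman_spaceI:
  assumes "open \<Omega>" "f holomorphic_on \<Omega>" "integrable (lebesgue_on \<Omega>) (\<lambda>z. (cmod (f z))\<^sup>2)"
  shows "f \<in> bergman_space \<Omega>"
  using assms holomorphic_measurable_lebesgue by (auto simp: bergman_space_def L2_space_def)

lemma bergman_spaceD:
  assumes "f \<in> bergman_space \<Omega>"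
  shows "f holomorphic_on \<Omega>" "integrable (lebesgue_on \<Omega>) (\<lambda>z. (cmod (f z))\<^sup>2)"
    "f \<in> borel_measurable (lebesgue_on \<Omega>)" "f \<in> L2_space \<Omega>"
  using assms by (auto simp: bergman_space_def L2_space_def)

lemma bergman_space_diff:
  assumes "open \<Omega>" "f \<in> bergman_space \<Omega>" "g \<in> bergman_space \<Omega>"
  shows "(\<lambda>z. f z - g z) \<in> bergman_space \<Omega>"
proof (rule bergman_spaceI[OF assms(1)])
  note f = bergman_spaceD[OF assms(2)] and g = bergman_spaceD[OF assms(3)]
  show "(\<lambda>z. f z - g z) holomorphic_on \<Omega>"
    using f g by (intro holomorphic_intros)
  have le: "(cmod (a - b))\<^sup>2 \<le> 2 * (cmod a)\<^sup>2 + 2 * (cmod b)\<^sup>2" for a b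
  proof -
    have "(cmod (a - b))\<^sup>2 \<le> (cmod a + cmod b)\<^sup>2"
      by (intro power_mono norm_triangle_ineq4) simp
    also have "\<dots> \<le> 2 * (cmod a)\<^sup>2 + 2 * (cmod b)\<^sup>2"
      using zero_le_power2[of "cmod a - cmod b"] by (simp add: power2_eq_square algebra_simps)
    finally show ?thesis .
  qed
  show "integrable (lebesgue_on \<Omega>) (\<lambda>z. (cmod (f z - g z))\<^sup>2)"
  proof (rule Bochner_Integration.integrable_bound)
    show "integrable (lebesgue_on \<Omega>) (\<lambda>z. 2 * (cmod (f z))\<^sup>2 + 2 * (cmod (g z))\<^sup>2)"
      using f(2) g(2) by simp
    show "(\<lambda>z. (cmod (f z - g z))\<^sup>2) \<in> borel_measurable (lebesgue_on \<Omega>)"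
      using f(3) g(3) by measurable
  qed (use le in simp)
qed

lemma bergman_space_cmult:
  assumes "open \<Omega>" "f \<in> bergman_space \<Omega>"
  shows "(\<lambda>z. c * f z) \<in> bergman_space \<Omega>"
  using assms bergman_spaceD[OF assms(2)]
  by (intro bergman_spaceI) (auto simp: norm_mult power_mult_distrib intro!: holomorphic_intros)

lemma L2_inner_commute: "L2_inner \<Omega> f g = cnj (L2_inner \<Omega> g f)"
  unfolding L2_inner_def Bochner_Integration.integral_cnj[symmetric] by (simp add: mult.commute)

lemma L2_inner_cong:
  assumes "\<And>z. z \<in> \<Omega> \<Longrightarrow> f z = f' z" "\<And>z. z \<in> \<Omega> \<Longrightarrow> g z = g' z"
  shows "L2_inner \<Omega> f g = L2_inner \<Omega> f' g'"
  unfolding L2_inner_def using assms by (intro Bochner_Integration.integral_cong) auto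

text \<open>
  An element of norm zero vanishes almost everywhere; by continuity the set where it does not vanish
  is open, and a nonempty open set is not a null set.
\<close>

lemma L2_inner_self_eq_0:
  assumes \<Omega>: "open \<Omega>" and f: "f \<in> bergman_space \<Omega>" and 0: "L2_inner \<Omega> f f = 0" and z: "z \<in> \<Omega>"
  shows "f z = 0"
proof (rule ccontr)
  assume nz: "f z \<noteq> 0"
  define N where "N = \<Omega> \<inter> f -` (- {0})"
  have N: "open N" "z \<in> N"
    unfolding N_def
    using bergman_spaceD(1)[OF f] \<Omega> nz z
    by (auto intro!: continuous_open_preimage holomorphic_on_imp_continuous_on)
  have "complex_of_real (LINT z|lebesgue_on \<Omega>. (cmod (f z))\<^sup>2) =
      (LINT z|lebesgue_on \<Omega>. complex_of_real ((cmod (f z))\<^sup>2))"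
    by (rule integral_complex_of_real[symmetric])
  also have "\<dots> = 0"
    unfolding complex_norm_square using 0 by (simp add: L2_inner_def)
  finally have "(LINT z|lebesgue_on \<Omega>. (cmod (f z))\<^sup>2) = 0" by (simp only: of_real_eq_0_iff)
  then have "AE z in lebesgue_on \<Omega>. (cmod (f z))\<^sup>2 = 0"
    using integral_nonneg_eq_0_iff_AE[OF bergman_spaceD(2)[OF f]] by simp
  then have "AE z in lebesgue. z \<in> \<Omega> \<longrightarrow> f z = 0"
    using \<Omega> by (subst (asm) AE_restrict_space_iff) auto
  then have "AE z\<in>N in lebesgue. z \<in> {}"
    by (auto simp: N_def)
  then show False
    using mem_closed_if_AE_lebesgue_open[OF N(1) closed_empty _ N(2)] by blast
qed

text \<open>
  The projection of an element of the Bergman space differs from it by an element orthogonal to the whole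
  space, hence to itself.
\<close>

lemma bergman_kernel_reproducing:
  assumes \<Omega>: "open \<Omega>" and K: "is_bergman_kernel \<Omega> K" and f: "f \<in> bergman_space \<Omega>" and z: "z \<in> \<Omega>"
  shows "f z = L2_inner \<Omega> f (\<lambda>w. cnj (K z w))"
proof -
  define h where "h = (\<lambda>z. LINT w|lebesgue_on \<Omega>. K z w * f w)"
  have h: "h \<in> bergman_space \<Omega>" "\<And>g. g \<in> bergman_space \<Omega> \<Longrightarrow> L2_inner \<Omega> (\<lambda>z. f z - h z) g = 0"
    using K bergman_spaceD(4)[OF f] unfolding is_bergman_kernel_def is_bergman_projection_def h_def by blast+
  have d: "(\<lambda>z. f z - h z) \<in> bergman_space \<Omega>"
    by (rule bergman_space_diff[OF \<Omega> f h(1)])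
  have "f z - h z = 0"
    using L2_inner_self_eq_0[OF \<Omega> d h(2)[OF d] z] by simp
  then show ?thesis
    by (simp add: h_def L2_inner_def mult.commute)
qed

text \<open>
  Evaluate \<open>k z\<close> with the kernel \<open>l\<close> and \<open>l w\<close> with the kernel \<open>k\<close>: both give the inner product of
  \<open>k z\<close> and \<open>l w\<close>, up to conjugation.  The case \<open>k = l\<close> gives Hermitian symmetry, and the two cases
  together give uniqueness.
\<close>

lemma reproducing_kernel_unique:
  assumes k: "\<And>z. z \<in> \<Omega> \<Longrightarrow> k z \<in> bergman_space \<Omega>"
    "\<And>z f. z \<in> \<Omega> \<Longrightarrow> f \<in> bergman_space \<Omega> \<Longrightarrow> f z = L2_inner \<Omega> f (k z)"
    and l: "\<And>z. z \<in> \<Omega> \<Longrightarrow> l z \<in> bergman_space \<Omega>"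
    "\<And>z f. z \<in> \<Omega> \<Longrightarrow> f \<in> bergman_space \<Omega> \<Longrightarrow> f z = L2_inner \<Omega> f (l z)"
    and z: "z \<in> \<Omega>" "w \<in> \<Omega>"
  shows "k z w = cnj (l w z)"
  using l(2)[OF z(2) k(1)[OF z(1)]] k(2)[OF z(1) l(1)[OF z(2)]] L2_inner_commute by metis

lemma bergman_kernel_hermitian:
  assumes \<Omega>: "open \<Omega>" and K: "is_bergman_kernel \<Omega> K" and z: "z \<in> \<Omega>" "w \<in> \<Omega>"
  shows "K z w = cnj (K w z)"
proof -
  let ?k = "\<lambda>z w. cnj (K z w)"
  have "?k w z = cnj (?k z w)"
    by (rule reproducing_kernel_unique[of \<Omega> ?k ?k])
      (use K z bergman_kernel_reproducing[OF \<Omega> K] in \<open>auto simp: is_bergman_kernel_def\<close>)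
  then show ?thesis by simp
qed

lemma holomorphic_bergman_kernel:
  assumes \<Omega>: "open \<Omega>" and K: "is_bergman_kernel \<Omega> K" and w: "w \<in> \<Omega>"
  shows "(\<lambda>z. K z w) holomorphic_on \<Omega>"
proof -
  have "(\<lambda>z. cnj (K w z)) holomorphic_on \<Omega>"
    using K w by (auto simp: is_bergman_kernel_def bergman_space_def)
  then show ?thesis
    by (rule holomorphic_transform) (use bergman_kernel_hermitian[OF \<Omega> K _ w] in auto)
qed

text \<open>
  Together with \<open>L2_inner_pullback\<close>, this says that an injective holomorphic map induces an
  isometry of Bergman spaces by composition and multiplication with its derivative.
\<close>

lemma bergman_space_pullback:
  assumes S: "open S" and g: "g holomorphic_on S" "inj_on g S" and f: "f \<in> bergman_space (g ` S)"
  shows "(\<lambda>z. deriv g z * f (g z)) \<in> bergman_space S"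
proof (rule bergman_spaceI[OF S])
  note f' = bergman_spaceD[OF f]
  show "(\<lambda>z. deriv g z * f (g z)) holomorphic_on S"
    using holomorphic_on_compose[OF g(1) f'(1)] g S by (auto intro!: holomorphic_intros simp: o_def)
  have "continuous_on (g ` S) (\<lambda>z. complex_of_real ((cmod (f z))\<^sup>2))"
    using f'(1) by (intro continuous_intros holomorphic_on_imp_continuous_on)
  from holomorphic_change_of_variables(1)[OF S g this]
  have "complex_integrable (lebesgue_on S) (\<lambda>z. of_real ((cmod (deriv g z))\<^sup>2) * of_real ((cmod (f (g z)))\<^sup>2))"
    using f'(2) by (simp only: complex_of_real_integrable_eq)
  then show "integrable (lebesgue_on S) (\<lambda>z. (cmod (deriv g z * f (g z)))\<^sup>2)"
    by (simp only: of_real_mult[symmetric] complex_of_real_integrable_eq norm_mult power_mult_distrib)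
qed

lemma L2_inner_pullback:
  assumes S: "open S" and g: "g holomorphic_on S" "inj_on g S"
    and f: "f holomorphic_on g ` S" and h: "h holomorphic_on g ` S"
  shows "L2_inner (g ` S) f h = L2_inner S (\<lambda>z. deriv g z * f (g z)) (\<lambda>z. deriv g z * h (g z))"
proof -
  have "continuous_on (g ` S) (\<lambda>z. f z * cnj (h z))"
    using f h by (intro continuous_intros holomorphic_on_imp_continuous_on)
  from holomorphic_change_of_variables(2)[OF S g this] show ?thesis
    unfolding L2_inner_def complex_norm_square of_real_power[symmetric]
    by (simp add: complex_norm_square mult_ac)
qed

text \<open>
  The right-hand side is a reproducing kernel of \<open>\<Omega>\<^sub>1\<close>: the isometry induced by \<open>\<Phi>\<close> is
  onto, with the one induced by the inverse mapping as its inverse, so each \<open>f\<close> is the pullback of some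
  \<open>F\<close>, to which the reproducing property on \<open>\<Omega>\<^sub>2\<close> applies.
\<close>

theorem bergman_kernel_transformation:
  assumes \<Omega>: "open \<Omega>\<^sub>1" "open \<Omega>\<^sub>2" and K: "is_bergman_kernel \<Omega>\<^sub>1 K\<^sub>1" "is_bergman_kernel \<Omega>\<^sub>2 K\<^sub>2"
    and \<Phi>: "biholomorphic \<Omega>\<^sub>1 \<Omega>\<^sub>2 \<Phi>" and z: "z \<in> \<Omega>\<^sub>1" and w: "w \<in> \<Omega>\<^sub>1"
  shows "K\<^sub>1 z w = deriv \<Phi> z * K\<^sub>2 (\<Phi> z) (\<Phi> w) * cnj (deriv \<Phi> w)"
proof -
  define \<Psi> where "\<Psi> = inv_into \<Omega>\<^sub>1 \<Phi>"
  have hol: "\<Phi> holomorphic_on \<Omega>\<^sub>1" and hol': "\<Psi> holomorphic_on \<Omega>\<^sub>2" and bij: "bij_betw \<Phi> \<Omega>\<^sub>1 \<Omega>\<^sub>2"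
    using \<Phi> by (auto simp: biholomorphic_def \<Psi>_def)
  have bij': "bij_betw \<Psi> \<Omega>\<^sub>2 \<Omega>\<^sub>1"
    unfolding \<Psi>_def by (rule bij_betw_inv_into[OF bij])
  have inj: "inj_on \<Phi> \<Omega>\<^sub>1" "inj_on \<Psi> \<Omega>\<^sub>2" and im: "\<Phi> ` \<Omega>\<^sub>1 = \<Omega>\<^sub>2" "\<Psi> ` \<Omega>\<^sub>2 = \<Omega>\<^sub>1"
    using bij bij' by (auto simp: bij_betw_def)
  have \<Psi>\<Phi>: "\<Psi> (\<Phi> z) = z" if "z \<in> \<Omega>\<^sub>1" for z
    using that inj by (simp add: \<Psi>_def)
  \<comment> \<open>The chain rule for \<open>\<Psi> \<circ> \<Phi> = id\<close> shows that the two pullbacks are inverse to each other.\<close>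
  have der: "deriv \<Phi> z * deriv \<Psi> (\<Phi> z) = 1" if "z \<in> \<Omega>\<^sub>1" for z
  proof -
    have "(\<Phi> has_field_derivative deriv \<Phi> z) (at z)"
      by (rule holomorphic_derivI[OF hol \<Omega>(1) that])
    moreover have "(\<Psi> has_field_derivative deriv \<Psi> (\<Phi> z)) (at (\<Phi> z))"
      using that im by (intro holomorphic_derivI[OF hol' \<Omega>(2)]) auto
    ultimately have "(\<Psi> \<circ> \<Phi> has_field_derivative deriv \<Psi> (\<Phi> z) * deriv \<Phi> z) (at z)"
      by (rule DERIV_chain[rotated])
    moreover have "((\<lambda>z. z) has_field_derivative 1) (at z)"
      by (rule DERIV_ident)
    then have "(\<Psi> \<circ> \<Phi> has_field_derivative 1) (at z)"
      by (rule has_field_derivative_transform_within_open[OF _ \<Omega>(1) that]) (simp add: \<Psi>\<Phi>)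
    ultimately show ?thesis
      by (metis DERIV_unique mult.commute)
  qed
  define k where "k = (\<lambda>z w. cnj (K\<^sub>2 z w))"
  have k: "k z \<in> bergman_space \<Omega>\<^sub>2" if "z \<in> \<Omega>\<^sub>2" for z
    using K(2) that by (auto simp: is_bergman_kernel_def k_def)
  \<comment> \<open>The candidate kernel: \<open>l z w\<close> is the conjugate of the right-hand side of the claim.\<close>
  define l where "l = (\<lambda>z w. cnj (deriv \<Phi> z) * (deriv \<Phi> w * k (\<Phi> z) (\<Phi> w)))"
  have k': "(\<lambda>w. deriv \<Phi> w * k (\<Phi> z) (\<Phi> w)) \<in> bergman_space \<Omega>\<^sub>1" if "z \<in> \<Omega>\<^sub>1" for z
    using bergman_space_pullback[OF \<Omega>(1) hol inj(1)] k that im by auto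
  then have l: "l z \<in> bergman_space \<Omega>\<^sub>1" if "z \<in> \<Omega>\<^sub>1" for z
    unfolding l_def using that by (intro bergman_space_cmult \<Omega>)
  have l_rep: "f z = L2_inner \<Omega>\<^sub>1 f (l z)" if z: "z \<in> \<Omega>\<^sub>1" and f: "f \<in> bergman_space \<Omega>\<^sub>1" for z f
  proof -
    define F where "F = (\<lambda>\<omega>. deriv \<Psi> \<omega> * f (\<Psi> \<omega>))"
    have F: "F \<in> bergman_space \<Omega>\<^sub>2"
      unfolding F_def using bergman_space_pullback[OF \<Omega>(2) hol' inj(2)] f im by auto
    have FP: "deriv \<Phi> w * F (\<Phi> w) = f w" if "w \<in> \<Omega>\<^sub>1" for w
      using der[OF that] \<Psi>\<Phi>[OF that] by (simp add: F_def flip: mult.assoc)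
    have "f z = deriv \<Phi> z * L2_inner \<Omega>\<^sub>2 F (k (\<Phi> z))"
      using FP[OF z] bergman_kernel_reproducing[OF \<Omega>(2) K(2) F, of "\<Phi> z"] z im by (auto simp: k_def)
    also have "L2_inner \<Omega>\<^sub>2 F (k (\<Phi> z)) =
        L2_inner \<Omega>\<^sub>1 (\<lambda>w. deriv \<Phi> w * F (\<Phi> w)) (\<lambda>w. deriv \<Phi> w * k (\<Phi> z) (\<Phi> w))"
      using L2_inner_pullback[OF \<Omega>(1) hol inj(1), of F "k (\<Phi> z)"] bergman_spaceD(1)[OF F]
        bergman_spaceD(1)[OF k] z im by auto
    also have "\<dots> = L2_inner \<Omega>\<^sub>1 f (\<lambda>w. deriv \<Phi> w * k (\<Phi> z) (\<Phi> w))"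
      by (rule L2_inner_cong) (simp_all add: FP)
    also have "deriv \<Phi> z * \<dots> = L2_inner \<Omega>\<^sub>1 f (l z)"
      unfolding L2_inner_def l_def integral_mult_right_zero[symmetric] by (simp add: mult_ac)
    finally show ?thesis .
  qed
  have "cnj (K\<^sub>1 w z) = cnj (l z w)"
    by (rule reproducing_kernel_unique[of \<Omega>\<^sub>1 "\<lambda>z w. cnj (K\<^sub>1 z w)" l, OF _ _ l l_rep w z])
      (use K(1) bergman_kernel_reproducing[OF \<Omega>(1) K(1)] in \<open>auto simp: is_bergman_kernel_def\<close>)
  then show ?thesis
    using bergman_kernel_hermitian[OF \<Omega>(1) K(1) z w] by (simp add: l_def k_def mult_ac)
qed

lemma bounded_holomorphic_in_bergman_space:
  assumes "open S" "bounded S" "f holomorphic_on S" "\<And>z. z \<in> S \<Longrightarrow> cmod (f z) \<le> B"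
  shows "f \<in> bergman_space S"
proof (rule bergman_spaceI[OF assms(1,3)])
  have "S \<in> lmeasurable" using assms by (intro bounded_set_imp_lmeasurable) auto
  then interpret finite_measure "lebesgue_on S" by (rule finite_measure_lebesgue_on)
  show "integrable (lebesgue_on S) (\<lambda>z. (cmod (f z))\<^sup>2)"
  proof (rule integrable_const_bound)
    show "AE z in lebesgue_on S. norm ((cmod (f z))\<^sup>2) \<le> B\<^sup>2"
      using assms(4) by (intro AE_I2) (auto intro!: power_mono)
    show "(\<lambda>z. (cmod (f z))\<^sup>2) \<in> borel_measurable (lebesgue_on S)"
      using holomorphic_measurable_lebesgue[OF assms(1,3)] by measurable
  qed
qed

text \<open>
  The functions are \<open>u = g'\<close> and \<open>g' g\<close> for the Riemann map \<open>g\<close> of a simply connected set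
  that contains \<open>\<Omega>\<close>.
\<close>

lemma bergman_space_separates_points:
  assumes dom: "plane_domain \<Omega>" and np: "no_point_boundary_component \<Omega>"
  obtains u g where "u \<in> bergman_space \<Omega>" "(\<lambda>z. u z * g z) \<in> bergman_space \<Omega>"
    "\<And>z. z \<in> \<Omega> \<Longrightarrow> u z \<noteq> 0" "inj_on g \<Omega>"
proof -
  have \<Omega>: "open \<Omega>" using dom by (simp add: plane_domain_def)
  obtain U where U: "open U" "simply_connected U" "\<Omega> \<subseteq> U" "U \<noteq> UNIV"
    using simply_connected_superset[OF dom np] by blast
  moreover have "U \<noteq> {}" using U dom by (auto simp: plane_domain_def)
  ultimately obtain g h where g: "g holomorphic_on U" "\<And>z. z \<in> U \<Longrightarrow> g z \<in> ball 0 1 \<and> h (g z) = z"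
    using Riemann_mapping_theorem[of U] by blast
  have inj: "inj_on g \<Omega>"
    using g(2) U(3) by (metis inj_on_inverseI inj_on_subset)
  have hol: "g holomorphic_on \<Omega>" using g(1) U(3) by (rule holomorphic_on_subset)
  have gS: "open (g ` \<Omega>)" using open_mapping_thm3[OF hol \<Omega> inj] .
  have sub: "g ` \<Omega> \<subseteq> ball 0 1" using g(2) U(3) by blast
  then have bdd: "bounded (g ` \<Omega>)" using bounded_ball bounded_subset by blast
  have "(\<lambda>z. 1) \<in> bergman_space (g ` \<Omega>)"
    by (rule bounded_holomorphic_in_bergman_space[OF gS bdd, of _ 1]) auto
  from bergman_space_pullback[OF \<Omega> hol inj this]
  have 1: "deriv g \<in> bergman_space \<Omega>" by simp
  have "(\<lambda>z. z) \<in> bergman_space (g ` \<Omega>)"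
    by (rule bounded_holomorphic_in_bergman_space[OF gS bdd, of _ 1]) (use sub in auto)
  from bergman_space_pullback[OF \<Omega> hol inj this]
  have 2: "(\<lambda>z. deriv g z * g z) \<in> bergman_space \<Omega>" by simp
  show ?thesis
    using that[OF 1 2 holomorphic_injective_imp_regular[OF hol \<Omega> inj] inj] .
qed

text \<open>
  Proportional columns force \<open>f a = cnj c * f b\<close> for all \<open>f\<close> in the Bergman space, in particular for
  \<open>u\<close> and \<open>u g\<close>; dividing gives \<open>g a = g b\<close>.  The conclusion \<open>c \<noteq> 0\<close>, applied with \<open>a = b\<close> and \<open>c = 0\<close>,
  excludes columns that vanish identically.
\<close>

lemma bergman_kernel_columns_independent:
  assumes dom: "plane_domain \<Omega>" and np: "no_point_boundary_component \<Omega>" and K: "is_bergman_kernel \<Omega> K"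
    and ab: "a \<in> \<Omega>" "b \<in> \<Omega>" and col: "\<And>z. z \<in> \<Omega> \<Longrightarrow> K z a = c * K z b"
  shows "c \<noteq> 0" "a = b"
proof -
  have \<Omega>: "open \<Omega>" using dom by (simp add: plane_domain_def)
  obtain u g where u: "u \<in> bergman_space \<Omega>" "(\<lambda>z. u z * g z) \<in> bergman_space \<Omega>"
    "\<And>z. z \<in> \<Omega> \<Longrightarrow> u z \<noteq> 0" and g: "inj_on g \<Omega>"
    using bergman_space_separates_points[OF dom np] by blast
  have *: "f a = cnj c * f b" if f: "f \<in> bergman_space \<Omega>" for f
  proof -
    have "f a = L2_inner \<Omega> f (\<lambda>w. cnj (K a w))"
      by (rule bergman_kernel_reproducing[OF \<Omega> K f ab(1)])
    also have "\<dots> = L2_inner \<Omega> f (\<lambda>w. c * cnj (K b w))"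
    proof (rule L2_inner_cong)
      fix w assume "w \<in> \<Omega>"
      then show "cnj (K a w) = c * cnj (K b w)"
        using col bergman_kernel_hermitian[OF \<Omega> K] ab by (metis complex_cnj_cnj)
    qed simp
    also have "\<dots> = cnj c * L2_inner \<Omega> f (\<lambda>w. cnj (K b w))"
      unfolding L2_inner_def integral_mult_right_zero[symmetric] by (simp add: mult_ac)
    also have "L2_inner \<Omega> f (\<lambda>w. cnj (K b w)) = f b"
      by (rule bergman_kernel_reproducing[OF \<Omega> K f ab(2), symmetric])
    finally show ?thesis .
  qed
  from *[OF u(1)] u(3)[OF ab(1)] show "c \<noteq> 0" by auto
  have "u a * g a = u a * g b"
    using *[OF u(1)] *[OF u(2)] by (simp add: mult.assoc)
  then have "g a = g b" using u(3)[OF ab(1)] by simp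
  then show "a = b" using g ab by (auto dest: inj_onD)
qed

section \<open>Algebraic elements over a subfield\<close>

text \<open>
  The theory of algebraic elements and finite extensions is stated for rings with an explicit
  carrier.  It is transferred here to subfields of a field given as a type.
\<close>

abbreviation type_ring :: "'a::field ring" where
  "type_ring \<equiv> ring_of_type_algebra"

definition algebraic_over :: "'a::field set \<Rightarrow> 'a \<Rightarrow> bool" where
  "algebraic_over K x \<longleftrightarrow> (\<exists>p. p \<noteq> 0 \<and> (\<forall>i. Polynomial.coeff p i \<in> K) \<and> poly p x = 0)"

lemma type_ring_simps [simp]:
  "carrier type_ring = UNIV" "\<zero>\<^bsub>type_ring\<^esub> = 0" "\<one>\<^bsub>type_ring\<^esub> = 1"
  "x \<oplus>\<^bsub>type_ring\<^esub> y = x + y" "x \<otimes>\<^bsub>type_ring\<^esub> y = x * y"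
  by (simp_all add: ring_of_type_algebra_def)

lemma type_ring_pow [simp]: "x [^]\<^bsub>type_ring\<^esub> (n :: nat) = (x :: 'a :: field) ^ n"
  by (induction n) (simp_all add: nat_pow_def ring_of_type_algebra_def mult.commute)

lemma type_ring_a_inv [simp]: "\<ominus>\<^bsub>type_ring\<^esub> x = - (x :: 'a :: field)"
proof -
  interpret field "type_ring :: 'a ring" by (rule field_from_type_algebra)
  show ?thesis by (rule minus_equality) simp_all
qed

lemma type_ring_inv [simp]:
  assumes "x \<noteq> 0"
  shows "inv\<^bsub>type_ring\<^esub> x = inverse (x :: 'a :: field)"
proof -
  interpret field "type_ring :: 'a ring" by (rule field_from_type_algebra)
  show ?thesis using assms by (intro inv_char) (simp_all add: field_simps)
qed

lemma subfield_typeI: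
  fixes K :: "'a :: field set"
  assumes "1 \<in> K" "\<And>x. x \<in> K \<Longrightarrow> - x \<in> K" "\<And>x y. x \<in> K \<Longrightarrow> y \<in> K \<Longrightarrow> x + y \<in> K"
    and "\<And>x y. x \<in> K \<Longrightarrow> y \<in> K \<Longrightarrow> x * y \<in> K" "\<And>x. x \<in> K \<Longrightarrow> inverse x \<in> K"
  shows "subfield K type_ring"
proof -
  interpret field "type_ring :: 'a ring" by (rule field_from_type_algebra)
  show ?thesis
    by (intro subfieldI' subringI) (use assms in auto)
qed

lemma subfield_typeD:
  fixes K :: "'a :: field set"
  assumes "subfield K type_ring"
  shows "0 \<in> K" "1 \<in> K" "x \<in> K \<Longrightarrow> - x \<in> K" "x \<in> K \<Longrightarrow> y \<in> K \<Longrightarrow> x + y \<in> K"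
    and "x \<in> K \<Longrightarrow> y \<in> K \<Longrightarrow> x * y \<in> K" "x \<in> K \<Longrightarrow> inverse x \<in> K" "x \<in> K \<Longrightarrow> y \<in> K \<Longrightarrow> x / y \<in> K"
proof -
  interpret field "type_ring :: 'a ring" by (rule field_from_type_algebra)
  have K: "subring K type_ring" using assms by (rule subfieldE(1))
  show 0: "0 \<in> K" "1 \<in> K" using subringE(2,3)[OF K] by simp_all
  show "x \<in> K \<Longrightarrow> - x \<in> K" "x \<in> K \<Longrightarrow> y \<in> K \<Longrightarrow> x + y \<in> K"
    using subringE(5,7)[OF K] by simp_all
  show m: "x \<in> K \<Longrightarrow> y \<in> K \<Longrightarrow> x * y \<in> K" for x y
    using subringE(6)[OF K] by simp
  show i: "inverse x \<in> K" if "x \<in> K" for x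
  proof (cases "x = 0")
    case False
    then show ?thesis
      using subfield_m_inv(1)[OF assms, of x] that by simp
  qed (use 0 in simp)
  show "x \<in> K \<Longrightarrow> y \<in> K \<Longrightarrow> x / y \<in> K"
    using m i by (simp add: divide_inverse)
qed

text \<open>
  The polynomials of the carrier-based theory are lists of coefficients with the leading coefficient first.
\<close>

lemma eval_type_ring: "ring.eval type_ring xs x = poly (Poly (rev xs)) (x :: 'a :: field)"
proof -
  interpret field "type_ring :: 'a ring" by (rule field_from_type_algebra)
  show ?thesis
    by (induction xs) (simp_all add: Poly_snoc poly_monom)
qed

lemma algebraic_over_iff:
  fixes K :: "'a :: field set"
  assumes "subfield K type_ring"
  shows "ring.algebraic type_ring K x \<longleftrightarrow> algebraic_over K x"
proof -
  interpret field "type_ring :: 'a ring" by (rule field_from_type_algebra)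
  note K = subfield_typeD[OF assms]
  show ?thesis
  proof
    assume "algebraic K x"
    then obtain xs where xs: "xs \<in> carrier (univ_poly type_ring K)" "xs \<noteq> []" "eval xs x = 0"
      using algebraicE[OF subfieldE(1)[OF assms], of x] by (auto simp: over_def)
    define p where "p = Poly (rev xs)"
    have xs': "set xs \<subseteq> K" "hd xs \<noteq> 0"
      using xs(1,2) by (auto simp: univ_poly_def polynomial_def)
    have "Polynomial.coeff p i \<in> K" for i
      using xs'(1) K(1) by (auto simp: p_def nth_default_def rev_nth)
    moreover have "Polynomial.coeff p (length xs - 1) = hd xs"
      using xs(2) by (simp add: p_def nth_default_def rev_nth hd_conv_nth)
    then have "p \<noteq> 0" using xs'(2) by auto
    moreover have "poly p x = 0" using xs(3) by (simp add: p_def eval_type_ring)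
    ultimately show "algebraic_over K x" by (auto simp: algebraic_over_def)
  next
    assume "algebraic_over K x"
    then obtain p where p: "p \<noteq> 0" "\<And>i. Polynomial.coeff p i \<in> K" "poly p x = 0"
      by (auto simp: algebraic_over_def)
    define xs where "xs = rev (coeffs p)"
    have "set xs \<subseteq> K" using p(2) by (auto simp: xs_def coeffs_def split: if_splits)
    moreover have "hd xs \<noteq> 0"
      using p(1) by (simp add: xs_def hd_rev last_coeffs_eq_coeff_degree)
    moreover have "xs \<noteq> []" using p(1) by (simp add: xs_def)
    moreover have "eval xs x = 0" using p(3) by (simp add: eval_type_ring xs_def)
    ultimately show "algebraic K x"
      using algebraicI[of xs K x] by (auto simp: univ_poly_def polynomial_def over_def)
  qed
qed

lemma subfield_algebraic_over:
  fixes K :: "'a :: field set"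
  assumes "subfield K type_ring"
  shows "subfield {x. algebraic_over K x} type_ring"
proof -
  interpret field "type_ring :: 'a ring" by (rule field_from_type_algebra)
  show ?thesis
    using subfield_of_algebraics[OF assms] by (simp add: over_def algebraic_over_iff[OF assms])
qed

lemma algebraic_over_mono: "algebraic_over K x \<Longrightarrow> K \<subseteq> L \<Longrightarrow> algebraic_over L x"
  by (auto simp: algebraic_over_def)

text \<open>
  The coefficients of an equation for \<open>x\<close> generate a finite extension of \<open>K\<close>, and \<open>x\<close> is algebraic over
  it; so \<open>x\<close> lies in a ring that has finite dimension over \<open>K\<close>.
\<close>

lemma algebraic_over_trans:
  fixes K :: "'a :: field set"
  assumes K: "subfield K type_ring" and x: "algebraic_over {y. algebraic_over K y} x"
  shows "algebraic_over K x"
proof -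
  interpret field "type_ring :: 'a ring" by (rule field_from_type_algebra)
  obtain p where p: "p \<noteq> 0" "\<And>i. algebraic_over K (Polynomial.coeff p i)" "poly p x = 0"
    using x by (auto simp: algebraic_over_def)
  define cs where "cs = coeffs p"
  define F where "F = finite_extension K cs"
  have cs: "(algebraic over K) c" if "c \<in> set cs" for c
  proof -
    have "\<exists>i. c = Polynomial.coeff p i"
      using that by (auto simp: cs_def coeffs_def split: if_splits)
    then show ?thesis using p(2) by (auto simp: over_def algebraic_over_iff[OF K])
  qed
  have F: "subfield F type_ring" "finite_dimension K F"
    unfolding F_def using cs finite_extension_is_subfield[OF K, of cs]
      finite_extension_finite_dimension(1)[OF K, of cs] by simp_all
  have "set cs \<subseteq> F"
    unfolding F_def by (rule finite_extension_mem[OF subfieldE(1)[OF K]]) simp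
  moreover have "0 \<in> F" using subfield_typeD(1)[OF F(1)] .
  ultimately have "Polynomial.coeff p i \<in> F" for i
    unfolding cs_def using coeff_in_coeffs[OF p(1), of i] coeff_eq_0[of p i]
    by (cases "i \<le> Polynomial.degree p") auto
  then have "algebraic_over F x"
    using p by (auto simp: algebraic_over_def)
  then have "(algebraic over F) x"
    by (simp add: algebraic_over_iff[OF F(1)] over_def)
  then have "finite_dimension F (simple_extension F x)"
    using finite_dimension_simple_extension[OF F(1), of x] by simp
  then have "finite_dimension K (simple_extension F x)"
    using telescopic_base_dim(1)[OF K F] by blast
  moreover have "x \<in> simple_extension F x" "subring (simple_extension F x) type_ring"
    using simple_extension_mem[OF subfieldE(1)[OF F(1)], of x]
      simple_extension_is_subring[OF subfieldE(1)[OF F(1)], of x] by simp_all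
  ultimately have "(algebraic over K) x"
    using finite_dimension_imp_algebraic[OF K] by blast
  then show ?thesis by (simp add: algebraic_over_iff[OF K] over_def)
qed

text \<open>
  The embedding \<open>\<iota>\<close> of constants is explicit because the constants and the ambient field are different types.
\<close>

locale field_embedding =
  fixes \<iota> :: "'k::field \<Rightarrow> 'a::field"
  assumes emb_add: "\<iota> (a + b) = \<iota> a + \<iota> b" and emb_mult: "\<iota> (a * b) = \<iota> a * \<iota> b" and emb_1: "\<iota> 1 = 1"
begin

lemma emb_0 [simp]: "\<iota> 0 = 0"
proof -
  have "\<iota> 0 = \<iota> 0 + \<iota> 0"
    using emb_add[of 0 0] by (simp only: add_0_left)
  then show ?thesis by (rule add_cancel_right_right[THEN iffD1])
qed

lemma emb_minus: "\<iota> (- a) = - \<iota> a"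
  using emb_add[of a "- a"] by (simp add: eq_neg_iff_add_eq_0 add.commute)

definition ev :: "'k poly \<Rightarrow> 'a \<Rightarrow> 'a" where
  "ev p t = poly (map_poly \<iota> p) t"

text \<open>
  The outer variable takes the value \<open>x\<close> and the inner one the value \<open>y\<close>, as in \<open>eval_poly2\<close>.
\<close>

definition ev2 :: "'k poly poly \<Rightarrow> 'a \<Rightarrow> 'a \<Rightarrow> 'a" where
  "ev2 P x y = poly (poly (map_poly (map_poly \<iota>) P) [:x:]) y"

definition transcendental_element :: "'a \<Rightarrow> bool" where
  "transcendental_element t \<longleftrightarrow> (\<forall>p. ev p t = 0 \<longrightarrow> p = 0)"

definition generated_field :: "'a \<Rightarrow> 'a set" where
  "generated_field t = {ev p t / ev q t | p q. ev q t \<noteq> 0}"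

lemma ev_0 [simp]: "ev 0 t = 0" 
  by (simp add: ev_def)

lemma ev_pCons [simp]: "ev (pCons a p) t = \<iota> a + t * ev p t"
  by (simp add: ev_def map_poly_pCons)

lemma ev_1 [simp]: "ev 1 t = 1"
  by (simp add: one_pCons emb_1)

lemma ev_add: "ev (p + q) t = ev p t + ev q t"
proof -
  have "map_poly \<iota> (p + q) = map_poly \<iota> p + map_poly \<iota> q"
    by (rule poly_eqI) (simp add: coeff_map_poly emb_add)
  then show ?thesis by (simp add: ev_def)
qed

lemma ev_smult: "ev (Polynomial.smult a p) t = \<iota> a * ev p t"
  by (induction p) (simp_all add: emb_mult algebra_simps)

lemma ev_mult: "ev (p * q) t = ev p t * ev q t"
  by (induction p) (simp_all add: ev_add ev_smult algebra_simps)

lemma ev_minus: "ev (- p) t = - ev p t"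
  using ev_add[of p "- p" t] by (simp add: eq_neg_iff_add_eq_0 add.commute)

lemma ev2_0 [simp]: "ev2 0 x y = 0"
  by (simp add: ev2_def)

lemma ev2_pCons [simp]: "ev2 (pCons p P) x y = ev p y + x * ev2 P x y"
  by (simp add: ev2_def ev_def map_poly_pCons)

lemma ev2_eq_poly: "ev2 P x y = poly (map_poly (\<lambda>p. ev p y) P) x"
  by (induction P) (simp_all add: map_poly_pCons)

lemma subfield_generated_field: "subfield (generated_field t) type_ring"
proof (rule subfield_typeI)
  have mem: "ev p t / ev q t \<in> generated_field t" if "ev q t \<noteq> 0" for p q
    using that by (auto simp: generated_field_def)
  show "1 \<in> generated_field t"
    using mem[of 1 1] by simp
  fix x assume "x \<in> generated_field t"
  then obtain p q where x: "x = ev p t / ev q t" "ev q t \<noteq> 0"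
    by (auto simp: generated_field_def)
  show "- x \<in> generated_field t"
    using mem[of q "- p"] x by (simp add: ev_minus)
  show "inverse x \<in> generated_field t"
    using mem[of p q] mem[of 1 0] x by (cases "ev p t = 0") simp_all
  fix y assume "y \<in> generated_field t"
  then obtain p' q' where y: "y = ev p' t / ev q' t" "ev q' t \<noteq> 0"
    by (auto simp: generated_field_def)
  show "x + y \<in> generated_field t"
    using mem[of "q * q'" "p * q' + p' * q"] x y by (simp add: ev_add ev_mult add_frac_eq)
  show "x * y \<in> generated_field t"
    using mem[of "q * q'" "p * p'"] x y by (simp add: ev_mult)
qed

lemma generated_field_subset:
  assumes L: "subfield L type_ring" and t: "t \<in> L" and const: "range \<iota> \<subseteq> L"
  shows "generated_field t \<subseteq> L"
proof -
  note L = subfield_typeD[OF L]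
  have "ev p t \<in> L" for p
    using const t by (induction p) (auto intro!: L)
  then show ?thesis
    using L(7) by (auto simp: generated_field_def)
qed

lemma ev_in_generated_field: "ev p t \<in> generated_field t"
proof -
  have "ev p t = ev p t / ev 1 t" "ev 1 t \<noteq> 0" by simp_all
  then show ?thesis unfolding generated_field_def by blast
qed

lemma const_in_generated_field: "range \<iota> \<subseteq> generated_field t"
  using ev_in_generated_field[of "[:a:]" t for a] by auto

lemma algebraic_over_generated_fieldI:
  assumes "transcendental_element t" "P \<noteq> 0" "ev2 P x t = 0"
  shows "algebraic_over (generated_field t) x"
proof -
  let ?p = "map_poly (\<lambda>p. ev p t) P"
  have "Polynomial.coeff ?p i \<in> generated_field t" for i
    by (simp add: coeff_map_poly ev_in_generated_field)
  moreover obtain i where "Polynomial.coeff P i \<noteq> 0"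
    using assms(2) by (auto simp: poly_eq_iff)
  then have "Polynomial.coeff ?p i \<noteq> 0"
    using assms(1) by (auto simp: coeff_map_poly transcendental_element_def)
  then have "?p \<noteq> 0" by auto
  ultimately show ?thesis
    using assms(3) by (auto simp: algebraic_over_def ev2_eq_poly)
qed

lemma clear_denominators:
  assumes "\<And>i. Polynomial.coeff p i \<in> generated_field t"
  shows "\<exists>d P. ev d t \<noteq> 0 \<and> Polynomial.smult (ev d t) p = map_poly (\<lambda>q. ev q t) P"
  using assms
proof (induction p)
  case 0
  show ?case by (rule exI[of _ 1], rule exI[of _ 0]) simp
next
  case (pCons a p)
  have "Polynomial.coeff p i \<in> generated_field t" for i
    using pCons.prems[of "Suc i"] by simp
  with pCons.IH obtain d P
    where d: "ev d t \<noteq> 0" "Polynomial.smult (ev d t) p = map_poly (\<lambda>q. ev q t) P" by blast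
  have "a \<in> generated_field t"
    using pCons.prems[of 0] by simp
  then obtain u v where a: "a = ev u t / ev v t" "ev v t \<noteq> 0"
    by (auto simp: generated_field_def)
  have "map_poly (\<lambda>q. ev q t) (Polynomial.smult v P) = Polynomial.smult (ev v t) (map_poly (\<lambda>q. ev q t) P)"
    by (rule poly_eqI) (simp add: coeff_map_poly ev_mult)
  then have "Polynomial.smult (ev (v * d) t) (pCons a p) =
      map_poly (\<lambda>q. ev q t) (pCons (d * u) (Polynomial.smult v P))"
    using a(2) by (simp add: map_poly_pCons ev_mult a(1) flip: d(2))
  moreover have "ev (v * d) t \<noteq> 0"
    using a d(1) by (simp add: ev_mult)
  ultimately show ?case by blast
qed

lemma algebraic_over_generated_fieldD:
  assumes "algebraic_over (generated_field t) x"
  obtains P where "P \<noteq> 0" "ev2 P x t = 0"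
proof -
  obtain p where p: "p \<noteq> 0" "\<And>i. Polynomial.coeff p i \<in> generated_field t" "poly p x = 0"
    using assms by (auto simp: algebraic_over_def)
  obtain d P where d: "ev d t \<noteq> 0" "Polynomial.smult (ev d t) p = map_poly (\<lambda>q. ev q t) P"
    using clear_denominators[OF p(2)] by blast
  have "ev2 P x t = 0"
    unfolding ev2_eq_poly d(2)[symmetric] using p(3) by simp
  moreover have "P \<noteq> 0"
    using d p(1) by auto
  ultimately show ?thesis using that by blast
qed

text \<open>
  Read the relation as an equation for \<open>y\<close>: its coefficients are polynomials in \<open>x\<close>, and one of them is
  nonzero because \<open>x\<close> is transcendental.
\<close>

lemma algebraic_over_generated_field_swap:
  assumes "transcendental_element x" "P \<noteq> 0" "ev2 P x y = 0"
  shows "algebraic_over (generated_field x) y"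
proof -
  define Q where "Q = poly (map_poly (map_poly \<iota>) P) [:x:]"
  have coeff_Q: "Polynomial.coeff Q j = ev (map_poly (\<lambda>p. Polynomial.coeff p j) P) x" for j
    unfolding Q_def
  proof (induction P)
    case (pCons p P)
    have "poly (map_poly (map_poly \<iota>) (pCons p P)) [:x:] =
        map_poly \<iota> p + Polynomial.smult x (poly (map_poly (map_poly \<iota>) P) [:x:])"
      by (simp add: map_poly_pCons)
    then show ?case
      using pCons.IH by (simp add: map_poly_pCons coeff_map_poly)
  qed simp
  have "Polynomial.coeff Q j \<in> generated_field x" for j
    by (simp add: coeff_Q ev_in_generated_field)
  moreover obtain i j where "Polynomial.coeff (Polynomial.coeff P i) j \<noteq> 0"
    using assms(2) by (auto simp: poly_eq_iff)
  then have "Polynomial.coeff (map_poly (\<lambda>p. Polynomial.coeff p j) P) i \<noteq> 0"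
    by (simp add: coeff_map_poly)
  then have "map_poly (\<lambda>p. Polynomial.coeff p j) P \<noteq> 0" by auto
  then have "Polynomial.coeff Q j \<noteq> 0"
    using assms(1) unfolding coeff_Q transcendental_element_def by blast
  then have "Q \<noteq> 0" by auto
  moreover have "poly Q y = 0"
    using assms(3) by (simp add: Q_def ev2_def)
  ultimately show ?thesis
    by (auto simp: algebraic_over_def)
qed

text \<open>
  The quotient \<open>r = a / b\<close> is algebraic over the field generated by \<open>t\<close> and, by \<open>eq\<close>, also over the field
  generated by \<open>u\<close>.  A relation between \<open>r\<close> and \<open>u\<close> makes \<open>u\<close> algebraic over the field generated by
  \<open>r\<close>, because \<open>r\<close> is transcendental, and then over the field generated by \<open>t\<close>, by transitivity.
\<close>

theorem algebraic_via_common_quotient: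
  assumes t: "transcendental_element t" and u: "transcendental_element u"
    and P: "P\<^sub>1 \<noteq> 0" "ev2 P\<^sub>1 a t = 0" "P\<^sub>2 \<noteq> 0" "ev2 P\<^sub>2 b t = 0"
    and Q: "Q\<^sub>1 \<noteq> 0" "ev2 Q\<^sub>1 c u = 0" "Q\<^sub>2 \<noteq> 0" "ev2 Q\<^sub>2 d u = 0"
    and eq: "a / b = \<iota> k * (c / d)" and r: "transcendental_element (a / b)"
  obtains P where "P \<noteq> 0" "ev2 P u t = 0"
proof -
  define A where "A = (\<lambda>t. {x. algebraic_over (generated_field t) x})"
  have A: "subfield (A t) type_ring" for t
    unfolding A_def by (rule subfield_algebraic_over[OF subfield_generated_field])
  have A_const: "range \<iota> \<subseteq> A t" for t
  proof
    fix x assume "x \<in> range \<iota>"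
    then have "x \<in> generated_field t" using const_in_generated_field by blast
    moreover have "1 \<in> generated_field t" "0 \<in> generated_field t" "- x \<in> generated_field t"
      using subfield_typeD[OF subfield_generated_field] calculation by auto
    ultimately have "Polynomial.coeff [:- x, 1:] i \<in> generated_field t" for i
      by (auto simp: coeff_pCons split: nat.splits)
    then show "x \<in> A t"
      unfolding A_def algebraic_over_def by (auto intro!: exI[of _ "[:- x, 1:]"])
  qed
  have "a / b \<in> A t"
    by (rule subfield_typeD(7)[OF A]) (use algebraic_over_generated_fieldI t P in \<open>auto simp: A_def\<close>)
  have "c \<in> A u" "d \<in> A u"
    using algebraic_over_generated_fieldI[OF u] Q by (auto simp: A_def)
  moreover have "\<iota> k \<in> A u"
    using A_const by blast
  ultimately have "a / b \<in> A u"
    unfolding eq using subfield_typeD(5,7)[OF A] by blast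
  then obtain R where "R \<noteq> 0" "ev2 R (a / b) u = 0"
    using algebraic_over_generated_fieldD unfolding A_def by blast
  then have "algebraic_over (generated_field (a / b)) u"
    using algebraic_over_generated_field_swap r by blast
  then have "algebraic_over (A t) u"
    using generated_field_subset[OF A \<open>a / b \<in> A t\<close> A_const] algebraic_over_mono by blast
  then have "algebraic_over (generated_field t) u"
    unfolding A_def by (rule algebraic_over_trans[OF subfield_generated_field])
  then show ?thesis
    using algebraic_over_generated_fieldD that by blast
qed

end

text \<open>
  Over an algebraically closed field of constants a polynomial splits into linear factors, and none of them
  vanishes at a nonconstant element.
\<close>

lemma (in field_embedding) transcendental_element_nonconstant:
  assumes closed: "\<And>p :: 'k poly. Polynomial.degree p > 0 \<Longrightarrow> \<exists>z. poly p z = 0"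
    and nonconst: "x \<notin> range \<iota>"
  shows "transcendental_element x"
  unfolding transcendental_element_def
proof (intro allI)
  fix p :: "'k poly"
  show "ev p x = 0 \<longrightarrow> p = 0"
  proof (induction "Polynomial.degree p" arbitrary: p rule: less_induct)
    case less
    show ?case
    proof (cases "Polynomial.degree p = 0")
      case True
      then obtain c where "p = [:c:]" by (rule degree_eq_zeroE)
      moreover have "c = 0" if "\<iota> c = 0"
        using that emb_mult[of c "inverse c"] emb_1 by (cases "c = 0") auto
      ultimately show ?thesis by simp
    next
      case False
      then obtain z where "poly p z = 0" using closed by blast
      then obtain q where q: "p = [:- z, 1:] * q" by (auto simp: poly_eq_0_iff_dvd)
      then have "q \<noteq> 0" using False by auto
      then have "Polynomial.degree q < Polynomial.degree p"
        unfolding q by (subst degree_mult_eq) auto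
      with less \<open>q \<noteq> 0\<close> have "ev q x \<noteq> 0" by blast
      moreover have "ev [:- z, 1:] x \<noteq> 0"
        using nonconst by (auto simp: emb_minus emb_1)
      ultimately have "ev p x \<noteq> 0"
        unfolding q ev_mult mult_eq_0_iff by blast
      then show ?thesis by blast
    qed
  qed
qed

section \<open>Columns of an algebraic kernel\<close>

definition slice :: "complex poly poly poly \<Rightarrow> complex \<Rightarrow> complex poly poly" where
  "slice P c = map_poly (map_poly (\<lambda>p. poly p c)) P"

lemma eval_poly2_pCons: "eval_poly2 (pCons p P) x y = poly p y + x * eval_poly2 P x y"
  by (simp add: eval_poly2_def)

lemma eval_poly2_slice: "eval_poly2 (slice P c) x y = eval_poly3 P x y c"
proof -
  have *: "poly (map_poly (\<lambda>p. poly p c) p) y = poly (poly p [:y:]) c" for p :: "complex poly poly"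
    by (induction p) (simp_all add: map_poly_pCons)
  show ?thesis
    unfolding slice_def
    by (induction P) (simp_all add: map_poly_pCons eval_poly2_pCons eval_poly3_def eval_poly2_def *)
qed

text \<open>
  A value \<open>c\<close> with vanishing slice is a common root of all coefficients, at least one of which is a
  nonzero polynomial in the third variable.
\<close>

lemma finite_zero_slices:
  assumes "P \<noteq> 0"
  shows "finite {c. slice P c = 0}"
proof -
  obtain i where i: "Polynomial.coeff P i \<noteq> 0"
    using assms by (auto simp: poly_eq_iff)
  then obtain j where j: "Polynomial.coeff (Polynomial.coeff P i) j \<noteq> 0"
    by (auto simp: poly_eq_iff)
  have "poly (Polynomial.coeff (Polynomial.coeff P i) j) c = 0" if "slice P c = 0" for c
  proof -
    have "Polynomial.coeff (Polynomial.coeff (slice P c) i) j = poly (Polynomial.coeff (Polynomial.coeff P i) j) c"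
      by (simp add: slice_def coeff_map_poly)
    then show ?thesis using that by simp
  qed
  then show ?thesis
    using poly_roots_finite[OF j] by (auto intro: finite_subset[rotated])
qed

lemma algebraic_kernel_columns:
  assumes "algebraic_kernel \<Omega> K"
  shows "finite {w \<in> \<Omega>. \<not> (\<exists>P. P \<noteq> 0 \<and> (\<forall>z \<in> \<Omega>. eval_poly2 P (K z w) z = 0))}"
proof -
  obtain P where P: "P \<noteq> 0" "\<And>z w. z \<in> \<Omega> \<Longrightarrow> w \<in> \<Omega> \<Longrightarrow> eval_poly3 P (K z w) z (cnj w) = 0"
    using assms unfolding algebraic_kernel_def algebraic2_on_def by fastforce
  have "{w \<in> \<Omega>. \<not> (\<exists>P. P \<noteq> 0 \<and> (\<forall>z \<in> \<Omega>. eval_poly2 P (K z w) z = 0))} \<subseteq> cnj ` {c. slice P c = 0}"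
  proof
    fix w assume w: "w \<in> {w \<in> \<Omega>. \<not> (\<exists>P. P \<noteq> 0 \<and> (\<forall>z \<in> \<Omega>. eval_poly2 P (K z w) z = 0))}"
    then have "slice P (cnj w) = 0"
      using P(2) by (auto simp: eval_poly2_slice)
    then show "w \<in> cnj ` {c. slice P c = 0}"
      by (intro image_eqI[of _ _ "cnj w"]) auto
  qed
  then show ?thesis
    using finite_zero_slices[OF P(1)] finite_subset by blast
qed

section \<open>Laurent expansions of holomorphic functions\<close>

interpretation fls: field_embedding "fls_const :: complex \<Rightarrow> complex fls"
  by unfold_locales (simp_all add: fls_const_mult_const fls_plus_const)

lemma has_laurent_expansion_poly:
  assumes "g has_laurent_expansion G"
  shows "(\<lambda>z. poly p (g z)) has_laurent_expansion fls.ev p G"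
  using assms by (induction p) (auto intro!: laurent_expansion_intros)

text \<open>
  Passing to Laurent series turns polynomial relations between holomorphic functions near a point into relations
  in the field \<open>complex fls\<close>, where quotients are available.
\<close>

lemma has_laurent_expansion_eval_poly2:
  assumes "f has_laurent_expansion F" "g has_laurent_expansion G"
  shows "(\<lambda>z. eval_poly2 P (f z) (g z)) has_laurent_expansion fls.ev2 P F G"
proof (induction P)
  case 0
  show ?case by (simp add: eval_poly2_def)
next
  case (pCons p P)
  then show ?case
    using has_laurent_expansion_poly[OF assms(2), of p] assms(1)
    by (auto simp: eval_poly2_pCons intro!: laurent_expansion_intros)
qed

lemma holomorphic_has_laurent_expansion:
  assumes "open S" "z \<in> S" "f holomorphic_on S"
  obtains F where "(\<lambda>w. f (z + w)) has_laurent_expansion F"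
  using analytic_at_imp_has_fps_expansion[of f z] has_laurent_expansion_fps
    holomorphic_on_imp_analytic_at[OF assms(3,1,2)] by blast

lemma eventually_shift_at_0:
  assumes "open S" "z \<in> S"
  shows "eventually (\<lambda>w. z + w \<in> S) (at (0::complex))"
proof -
  have "open ((\<lambda>w. z + w) -` S)"
    using assms(1) by (intro open_vimage continuous_intros) 
  then show ?thesis
    using assms(2) eventually_at_in_open'[of "(\<lambda>w. z + w) -` S" 0] by simp
qed

lemma laurent_expansion_cong_on:
  assumes "open S" "z \<in> S" "\<And>w. w \<in> S \<Longrightarrow> f w = g w"
    and "(\<lambda>w. f (z + w)) has_laurent_expansion F" "(\<lambda>w. g (z + w)) has_laurent_expansion G"
  shows "F = G"
proof -
  have "eventually (\<lambda>w. f (z + w) = g (z + w)) (at 0)"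
    using eventually_shift_at_0[OF assms(1,2)] by eventually_elim (rule assms(3))
  then have "(\<lambda>w. f (z + w)) has_laurent_expansion G"
    using assms(5) has_laurent_expansion_cong[of "\<lambda>w. f (z + w)" "\<lambda>w. g (z + w)" G G] by simp
  then show ?thesis
    using assms(4) has_laurent_expansion_unique by blast
qed

text \<open>
  The difference of the functions vanishes near \<open>z\<close>, hence on all of \<open>S\<close> by analytic continuation.
\<close>

lemma laurent_expansion_eq_imp_eq_on:
  assumes S: "open S" "connected S" "z \<in> S" and hol: "f holomorphic_on S" "g holomorphic_on S"
    and exp: "(\<lambda>w. f (z + w)) has_laurent_expansion F" "(\<lambda>w. g (z + w)) has_laurent_expansion F"
    and w: "w \<in> S"
  shows "f w = g w"
proof -
  have "(\<lambda>w. f (z + w) - g (z + w)) has_laurent_expansion F - F"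
    using exp by (intro laurent_expansion_intros)
  then have "eventually (\<lambda>w. f (z + w) - g (z + w) = 0) (at 0)"
    by (simp add: has_laurent_expansion_def)
  then obtain e where e: "e > 0" "\<And>w. w \<noteq> 0 \<Longrightarrow> dist w 0 < e \<Longrightarrow> f (z + w) - g (z + w) = 0"
    by (auto simp: eventually_at)
  define U where "U = S \<inter> ball z e - {z}"
  have "f w - g w = 0"
  proof (rule analytic_continuation[of "\<lambda>w. f w - g w" S U z])
    show "(\<lambda>w. f w - g w) holomorphic_on S" using hol by (intro holomorphic_intros)
    have "z islimpt S \<inter> ball z e"
      using S e by (intro interior_limit_point) (auto simp: interior_open)
    then show "z islimpt U"
      unfolding U_def by (simp add: islimpt_punctured[symmetric])
    show "f w - g w = 0" if "w \<in> U" for w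
      using e(2)[of "w - z"] that by (auto simp: U_def dist_norm norm_minus_commute)
  qed (use S w in \<open>auto simp: U_def\<close>)
  then show ?thesis by simp
qed

lemma laurent_expansion_transcendental:
  assumes S: "open S" "connected S" "z \<in> S" and hol: "f holomorphic_on S"
    and exp: "(\<lambda>w. f (z + w)) has_laurent_expansion F" and ab: "a \<in> S" "b \<in> S" "f a \<noteq> f b"
  shows "fls.transcendental_element F"
proof (rule fls.transcendental_element_nonconstant)
  show "\<exists>z. poly p z = 0" if "Polynomial.degree p > 0" for p :: "complex poly"
    using fundamental_theorem_of_algebra[of p] that by (auto simp: constant_degree)
  show "F \<notin> range fls_const"
  proof
    assume "F \<in> range fls_const"
    then obtain c where "F = fls_const c" by auto
    then have "f w = c" if "w \<in> S" for w
      using laurent_expansion_eq_imp_eq_on[OF S hol _ exp, of "\<lambda>_. c" w] that by simp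
    then show False using ab by auto
  qed
qed

section \<open>Algebraicity of the mapping\<close>

theorem corollary3p3:
  fixes \<Omega>\<^sub>1 \<Omega>\<^sub>2 :: "complex set"
    and K\<^sub>1 K\<^sub>2 :: "complex \<Rightarrow> complex \<Rightarrow> complex"
    and \<Phi> :: "complex \<Rightarrow> complex"
  assumes "plane_domain \<Omega>\<^sub>1" and "plane_domain \<Omega>\<^sub>2"
    and "finitely_connected \<Omega>\<^sub>1" and "finitely_connected \<Omega>\<^sub>2"
    and "no_point_boundary_component \<Omega>\<^sub>1" and "no_point_boundary_component \<Omega>\<^sub>2"
    and "is_bergman_kernel \<Omega>\<^sub>1 K\<^sub>1" and "is_bergman_kernel \<Omega>\<^sub>2 K\<^sub>2"
    and "algebraic_kernel \<Omega>\<^sub>1 K\<^sub>1" and "algebraic_kernel \<Omega>\<^sub>2 K\<^sub>2"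
    and "biholomorphic \<Omega>\<^sub>1 \<Omega>\<^sub>2 \<Phi>"
  shows "algebraic_on \<Omega>\<^sub>1 \<Phi>"
proof -
  note dom = assms(1,2) and np = assms(5,6) and K = assms(7,8)
  have op: "open \<Omega>\<^sub>1" "open \<Omega>\<^sub>2" and con: "connected \<Omega>\<^sub>1" and ne: "\<Omega>\<^sub>1 \<noteq> {}"
    using dom by (auto simp: plane_domain_def)
  have hol: "\<Phi> holomorphic_on \<Omega>\<^sub>1" and inj: "inj_on \<Phi> \<Omega>\<^sub>1" and im: "\<Phi> ` \<Omega>\<^sub>1 = \<Omega>\<^sub>2"
    using assms(11) by (auto simp: biholomorphic_def bij_betw_def)
  have im': "\<Phi> z \<in> \<Omega>\<^sub>2" if "z \<in> \<Omega>\<^sub>1" for z using im that by blast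
  \<comment> \<open>The points \<open>w\<close> whose column \<open>K z w\<close> is an algebraic function of \<open>z\<close>; all but finitely many are good.\<close>
  define good where
    "good = (\<lambda>\<Omega> K (w :: complex). \<exists>P. P \<noteq> 0 \<and> (\<forall>z \<in> \<Omega>. eval_poly2 P (K z w :: complex) z = 0))"
  define bad where "bad = {w \<in> \<Omega>\<^sub>1. \<not> good \<Omega>\<^sub>1 K\<^sub>1 w} \<union> {w \<in> \<Omega>\<^sub>1. \<not> good \<Omega>\<^sub>2 K\<^sub>2 (\<Phi> w)}"
  have "finite {w \<in> \<Omega>\<^sub>1. \<not> good \<Omega>\<^sub>2 K\<^sub>2 (\<Phi> w)}"
  proof (rule inj_on_finite[of \<Phi>])
    show "finite {w \<in> \<Omega>\<^sub>2. \<not> good \<Omega>\<^sub>2 K\<^sub>2 w}"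
      using algebraic_kernel_columns[OF assms(10)] by (simp add: good_def)
  qed (use inj im' in \<open>auto intro: inj_on_subset\<close>)
  then have "finite bad"
    unfolding bad_def using algebraic_kernel_columns[OF assms(9)] by (simp add: good_def)
  moreover have "infinite \<Omega>\<^sub>1"
    using op ne finite_imp_not_open by blast
  ultimately have inf: "infinite (\<Omega>\<^sub>1 - bad)" by simp
  then obtain p where p: "p \<in> \<Omega>\<^sub>1 - bad" using infinite_imp_nonempty by blast
  have "infinite (\<Omega>\<^sub>1 - bad - {p})" using inf by simp
  then have "\<Omega>\<^sub>1 - bad - {p} \<noteq> {}" by (rule infinite_imp_nonempty)
  then obtain q where q: "q \<in> \<Omega>\<^sub>1 - bad" "q \<noteq> p" by blast
  have pq: "p \<in> \<Omega>\<^sub>1" "q \<in> \<Omega>\<^sub>1" using p q by auto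
  obtain P\<^sub>1 P\<^sub>2 Q\<^sub>1 Q\<^sub>2 where
    P1: "P\<^sub>1 \<noteq> 0" "\<And>z. z \<in> \<Omega>\<^sub>1 \<Longrightarrow> eval_poly2 P\<^sub>1 (K\<^sub>1 z p) z = 0" and
    P2: "P\<^sub>2 \<noteq> 0" "\<And>z. z \<in> \<Omega>\<^sub>1 \<Longrightarrow> eval_poly2 P\<^sub>2 (K\<^sub>1 z q) z = 0" and
    Q1: "Q\<^sub>1 \<noteq> 0" "\<And>z. z \<in> \<Omega>\<^sub>2 \<Longrightarrow> eval_poly2 Q\<^sub>1 (K\<^sub>2 z (\<Phi> p)) z = 0" and
    Q2: "Q\<^sub>2 \<noteq> 0" "\<And>z. z \<in> \<Omega>\<^sub>2 \<Longrightarrow> eval_poly2 Q\<^sub>2 (K\<^sub>2 z (\<Phi> q)) z = 0"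
    using p q unfolding bad_def good_def by blast
  define a b c d where "a = (\<lambda>z. K\<^sub>1 z p)" and "b = (\<lambda>z. K\<^sub>1 z q)"
    and "c = (\<lambda>z. K\<^sub>2 (\<Phi> z) (\<Phi> p))" and "d = (\<lambda>z. K\<^sub>2 (\<Phi> z) (\<Phi> q))"
  have hol2: "(\<lambda>z. K\<^sub>2 (\<Phi> z) w) holomorphic_on \<Omega>\<^sub>1" if "w \<in> \<Omega>\<^sub>2" for w
    using holomorphic_on_compose[OF hol, of "\<lambda>z. K\<^sub>2 z w"] holomorphic_bergman_kernel[OF op(2) K(2) that] im
    by (simp add: o_def)
  have hols: "a holomorphic_on \<Omega>\<^sub>1" "b holomorphic_on \<Omega>\<^sub>1" "c holomorphic_on \<Omega>\<^sub>1" "d holomorphic_on \<Omega>\<^sub>1"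
    unfolding a_def b_def c_def d_def
    using holomorphic_bergman_kernel[OF op(1) K(1)] hol2 pq im' by auto
  \<comment> \<open>Any point \<open>z\<close> of \<open>\<Omega>\<^sub>1\<close> can serve as the centre of the expansions.\<close>
  obtain z where z: "z \<in> \<Omega>\<^sub>1" using ne by blast
  obtain A where A: "(\<lambda>w. a (z + w)) has_laurent_expansion A"
    using holomorphic_has_laurent_expansion[OF op(1) z hols(1)] .
  obtain B where B: "(\<lambda>w. b (z + w)) has_laurent_expansion B"
    using holomorphic_has_laurent_expansion[OF op(1) z hols(2)] .
  obtain C where C: "(\<lambda>w. c (z + w)) has_laurent_expansion C"
    using holomorphic_has_laurent_expansion[OF op(1) z hols(3)] .
  obtain D where D: "(\<lambda>w. d (z + w)) has_laurent_expansion D"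
    using holomorphic_has_laurent_expansion[OF op(1) z hols(4)] .
  obtain U where U: "(\<lambda>w. \<Phi> (z + w)) has_laurent_expansion U"
    using holomorphic_has_laurent_expansion[OF op(1) z hol] .
  obtain T where T: "(\<lambda>w. z + w) has_laurent_expansion T"
    using holomorphic_has_laurent_expansion[OF op(1) z, of "\<lambda>w. w"] by auto
  have rel: "fls.ev2 P F G = 0"
    if "(\<lambda>w. f (z + w)) has_laurent_expansion F" "(\<lambda>w. g (z + w)) has_laurent_expansion G"
      "\<And>w. w \<in> \<Omega>\<^sub>1 \<Longrightarrow> eval_poly2 P (f w) (g w) = 0" for P f g F G
    by (rule laurent_expansion_cong_on[OF op(1) z that(3) has_laurent_expansion_eval_poly2[OF that(1,2)]]) auto
  have transT: "fls.transcendental_element T"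
    by (rule laurent_expansion_transcendental[of \<Omega>\<^sub>1 z "\<lambda>w. w" T p q]) (use op con z T pq q in auto)
  have transU: "fls.transcendental_element U"
    by (rule laurent_expansion_transcendental[of \<Omega>\<^sub>1 z \<Phi> U p q])
      (use op con z U pq q hol inj in \<open>auto dest: inj_onD\<close>)
  have "B \<noteq> 0"
  proof
    assume "B = 0"
    then have "b w = 0" if "w \<in> \<Omega>\<^sub>1" for w
      using laurent_expansion_eq_imp_eq_on[OF op(1) con z hols(2) _ B, of "\<lambda>_. 0"] that by simp
    then show False
      using bergman_kernel_columns_independent(1)[OF dom(1) np(1) K(1) pq(2) pq(2), of 0] by (simp add: b_def)
  qed
  have "D \<noteq> 0"
  proof
    assume "D = 0"
    then have "d w = 0" if "w \<in> \<Omega>\<^sub>1" for w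
      using laurent_expansion_eq_imp_eq_on[OF op(1) con z hols(4) _ D, of "\<lambda>_. 0"] that by simp
    then have "K\<^sub>2 w (\<Phi> q) = 0" if "w \<in> \<Omega>\<^sub>2" for w
      using that im by (auto simp: d_def)
    then show False
      using bergman_kernel_columns_independent(1)[OF dom(2) np(2) K(2), of "\<Phi> q" "\<Phi> q" 0] im' pq by simp
  qed
  have transAB: "fls.transcendental_element (A / B)"
  proof (rule fls.transcendental_element_nonconstant)
    show "\<exists>z. poly p z = 0" if "Polynomial.degree p > 0" for p :: "complex poly"
      using fundamental_theorem_of_algebra[of p] that by (auto simp: constant_degree)
    show "A / B \<notin> range fls_const"
    proof
      assume "A / B \<in> range fls_const"
      then obtain k where "A = fls_const k * B" using \<open>B \<noteq> 0\<close> by (auto simp: field_simps)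
      moreover have "(\<lambda>w. k * b (z + w)) has_laurent_expansion fls_const k * B"
        using B by (intro laurent_expansion_intros)
      moreover have "(\<lambda>w. k * b w) holomorphic_on \<Omega>\<^sub>1"
        using hols(2) by (intro holomorphic_intros)
      ultimately have "a w = k * b w" if "w \<in> \<Omega>\<^sub>1" for w
        using laurent_expansion_eq_imp_eq_on[OF op(1) con z hols(1) _ A, of "\<lambda>w. k * b w" w] that by simp
      then show False
        using bergman_kernel_columns_independent(2)[OF dom(1) np(1) K(1) pq] q(2) by (auto simp: a_def b_def)
    qed
  qed
  \<comment> \<open>The values of the conjugated derivative at the two base points form the constant \<open>k = m / n\<close>; the factor \<open>\<Phi>'(z)\<close> cancels.\<close>
  define m n where "m = cnj (deriv \<Phi> p)" and "n = cnj (deriv \<Phi> q)"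
  have n: "n \<noteq> 0"
    using holomorphic_injective_imp_regular[OF hol op(1) inj pq(2)] by (simp add: n_def)
  \<comment> \<open>Multiplied out, the equation of the two quotients holds pointwise on \<open>\<Omega>\<^sub>1\<close>, also at zeros of the denominators.\<close>
  have "A * (fls_const n * D) = fls_const m * C * B"
  proof (rule laurent_expansion_cong_on[OF op(1) z])
    fix w assume w: "w \<in> \<Omega>\<^sub>1"
    show "a w * (n * d w) = m * c w * b w"
      using bergman_kernel_transformation[OF op K assms(11) w] pq
      by (simp add: a_def b_def c_def d_def m_def n_def)
  qed (intro laurent_expansion_intros A B C D)+
  moreover have N: "fls_const n \<noteq> 0" "fls_const (m / n) = fls_const m / fls_const n"
    using n by (simp_all add: nonzero_eq_divide_eq fls_const_mult_const)
  ultimately have "A / B = fls_const m * C / (fls_const n * D)"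
    using \<open>B \<noteq> 0\<close> \<open>D \<noteq> 0\<close> by (simp only: frac_eq_eq mult_eq_0_iff simp_thms)
  then have quot: "A / B = fls_const (m / n) * (C / D)"
    by (simp only: N(2) times_divide_times_eq)
  have "fls.ev2 P\<^sub>1 A T = 0" "fls.ev2 P\<^sub>2 B T = 0" "fls.ev2 Q\<^sub>1 C U = 0" "fls.ev2 Q\<^sub>2 D U = 0"
    using rel[OF A T, of P\<^sub>1] rel[OF B T, of P\<^sub>2] rel[OF C U, of Q\<^sub>1] rel[OF D U, of Q\<^sub>2]
      P1(2) P2(2) Q1(2) Q2(2) im' by (simp_all add: a_def b_def c_def d_def)
  then obtain P where P: "P \<noteq> 0" "fls.ev2 P U T = 0"
    using fls.algebraic_via_common_quotient[OF transT transU P1(1) _ P2(1) _ Q1(1) _ Q2(1) _ quot transAB]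
    by blast
  have hol_eval: "(\<lambda>w. eval_poly2 P (\<Phi> w) w) holomorphic_on \<Omega>\<^sub>1"
  proof (induction P)
    case 0
    show ?case by (simp add: eval_poly2_def)
  next
    case (pCons p P)
    then show ?case
      unfolding eval_poly2_pCons using hol by (intro holomorphic_intros)
  qed
  have "eval_poly2 P (\<Phi> w) w = 0" if "w \<in> \<Omega>\<^sub>1" for w
    using laurent_expansion_eq_imp_eq_on[OF op(1) con z hol_eval _ _ _ that, of "\<lambda>_. 0" 0]
      has_laurent_expansion_eval_poly2[OF U T, of P] P(2) by simp
  then show ?thesis
    unfolding algebraic_on_def using hol P by blast
qed

end
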